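(* Let $k\in\{2,3,4\}$, let $i$ be an integer with $k\ge i\ge 1$, and let $n\ge 0$. Then \[ \sum_{n_1\geq \dots\geq n_{k-1}\geq n_k=0} q^{n_1^2+\dots+n_{k-1}^2 + n_i+\dots +n_{k-1}} \prod_{j=1}^{k-1} {2n- 2\sum_{l=1}^{j-1}n_l -n_j - n_{j+1} -2 \alpha_{ij} \brack n_j - n_{j+1}}'_q = \sum_{r=-\infty}^{\infty} (-1)^r q^{\frac{r( (2k+1)r + 2k-2i +1)}{2}} {2n\brack n - \frac{(2k+1)r}{2} + (2k-2i+1)\frac{(-1)^r-1}{4}}_q, \] where the left sum runs over integers $n_1\ge n_2\ge\dots\ge n_{k-1}\ge0$ with $n_k:=0$, and $n_i+\dots+n_{k-1}$ is $0$ when $i=k$. Furthermore, for $k\in\{2,3\}$ and $i\in\{1,2\}$, \[ CP_{(2k-i,i-1)}(n) = \frac{1}{(q;q)_{2n}} \sum_{r=-\infty}^{\infty} (-1)^r q^{\frac{r( (2k+1)r + 2k-2i +1)}{2}} {2n\brack n - \frac{(2k+1)r}{2} + (2k-2i+1)\frac{(-1)^r-1}{4}}_q. \]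
   Context: $\alpha_{ij}:=\max\{j-i+1,0\}$. $(a;q)_m=\prod_{j=0}^{m-1}(1-aq^j)$. For integers $a,b$, ${a\brack b}_q=\frac{(q;q)_a}{(q;q)_b(q;q)_{a-b}}$ if $0\le b\le a$ and $0$ otherwise; the modified coefficient ${a\brack b}'_q$ equals $1$ if $a<0$ and $b=0$, and equals ${a\brack b}_q$ otherwise. A cylindric partition with profile $(c_1,c_2)$ is a pair of partitions $(\lambda^{(1)},\lambda^{(2)})$ (parts in weakly decreasing order, $\lambda^{(i)}_j=0$ beyond the number of parts) with $\lambda^{(1)}_j\ge\lambda^{(2)}_{j+c_2}$ and $\lambda^{(2)}_j\ge\lambda^{(1)}_{j+c_1}$ for all $j\ge1$; its size is $|\lambda^{(1)}|+|\lambda^{(2)}|$. $CP_{(a,b)}(n)$ is the generating function $\sum q^{\text{size}}$ over cylindric partitions of profile $(a,b)$ in which each partition has at most $n$ parts, with $CP_{(a,b)}(0)=1$. *)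

theory Defs
  imports "HOL-Analysis.Analysis" "HOL-Computational_Algebra.Formal_Power_Series"
begin

text \<open>
  The indeterminate \<open>q\<close> is \<^term>\<open>fps_X :: rat fps\<close>: all identities are identities of formal
  power series in \<open>\<rat>[[q]]\<close>. Infinite sums are taken in the standard (\<open>q\<close>-adic) topology
  of \<^typ>\<open>rat fps\<close>; the lemmas below show that the sums involved have finite support.
\<close>

abbreviation q :: "rat fps" where "q \<equiv> fps_X"

definition qpoch :: "rat fps \<Rightarrow> rat fps \<Rightarrow> nat \<Rightarrow> rat fps" where
  "qpoch a x m = (\<Prod>j<m. 1 - a * x ^ j)"

definition qbinom :: "int \<Rightarrow> int \<Rightarrow> rat fps" where
  "qbinom a b =
     (if 0 \<le> b \<and> b \<le> a
      then qpoch q q (nat a) / (qpoch q q (nat b) * qpoch q q (nat (a - b)))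
      else 0)"

definition qbinom' :: "int \<Rightarrow> int \<Rightarrow> rat fps" where
  "qbinom' a b = (if a < 0 \<and> b = 0 then 1 else qbinom a b)"

definition alpha :: "nat \<Rightarrow> nat \<Rightarrow> int" where
  "alpha i j = max (int j - int i + 1) 0"

text \<open>
  A tuple \<open>n\<^sub>1 \<ge> \<dots> \<ge> n\<^sub>k\<^sub>-\<^sub>1 \<ge> n\<^sub>k = 0\<close> is the function \<open>\<nu>\<close> with
  \<open>\<nu> j = n\<^sub>j\<close> for \<open>1 \<le> j < k\<close> and \<open>\<nu> j = 0\<close> for every other \<open>j\<close>.
\<close>

definition tuples :: "nat \<Rightarrow> (nat \<Rightarrow> nat) set" where
  "tuples k = {\<nu>. (\<forall>j. j \<notin> {1..<k} \<longrightarrow> \<nu> j = 0) \<and> (\<forall>j\<in>{1..<k}. \<nu> (j + 1) \<le> \<nu> j)}"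

definition lhs_term :: "nat \<Rightarrow> nat \<Rightarrow> nat \<Rightarrow> (nat \<Rightarrow> nat) \<Rightarrow> rat fps" where
  "lhs_term k i n \<nu> =
     q ^ ((\<Sum>j\<in>{1..<k}. (\<nu> j)\<^sup>2) + (\<Sum>j\<in>{i..<k}. \<nu> j)) *
     (\<Prod>j\<in>{1..<k}.
        qbinom' (2 * int n - 2 * (\<Sum>l\<in>{1..<j}. int (\<nu> l)) - int (\<nu> j) - int (\<nu> (j + 1))
                   - 2 * alpha i j)
                (int (\<nu> j) - int (\<nu> (j + 1))))"

definition neg_one_pow :: "int \<Rightarrow> 'a::ring_1" where
  "neg_one_pow r = (if even r then 1 else - 1)"

text \<open>
  The divisions in the next two definitions are exact, see \<open>rhs_exponent\<close> and \<open>rhs_index\<close>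
  below.
\<close>

definition rhs_exp :: "nat \<Rightarrow> nat \<Rightarrow> int \<Rightarrow> int" where
  "rhs_exp k i r = (r * ((2 * int k + 1) * r + 2 * int k - 2 * int i + 1)) div 2"

definition rhs_idx :: "nat \<Rightarrow> nat \<Rightarrow> nat \<Rightarrow> int \<Rightarrow> int" where
  "rhs_idx k i n r =
     int n + ((2 * int k - 2 * int i + 1) * (neg_one_pow r - 1) - 2 * (2 * int k + 1) * r) div 4"

definition rhs_term :: "nat \<Rightarrow> nat \<Rightarrow> nat \<Rightarrow> int \<Rightarrow> rat fps" where
  "rhs_term k i n r =
     neg_one_pow r * q ^ nat (rhs_exp k i r) * qbinom (2 * int n) (rhs_idx k i n r)"

text \<open>A partition is the list of its positive parts in weakly decreasing order.\<close>

definition is_partition :: "nat list \<Rightarrow> bool" where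
  "is_partition xs \<longleftrightarrow> sorted_wrt (\<ge>) xs \<and> 0 \<notin> set xs"

definition part :: "nat list \<Rightarrow> nat \<Rightarrow> nat" where
  "part xs j = (if 1 \<le> j \<and> j \<le> length xs then xs ! (j - 1) else 0)"

definition cylindric_partition :: "nat \<Rightarrow> nat \<Rightarrow> nat list \<times> nat list \<Rightarrow> bool" where
  "cylindric_partition c1 c2 = (\<lambda>(xs, ys).
     is_partition xs \<and> is_partition ys \<and>
     (\<forall>j\<ge>1. part xs j \<ge> part ys (j + c2)) \<and>
     (\<forall>j\<ge>1. part ys j \<ge> part xs (j + c1)))"

definition CP :: "nat \<Rightarrow> nat \<Rightarrow> nat \<Rightarrow> rat fps" where
  "CP a b n = Abs_fps (\<lambda>m. of_nat (card
     {(xs, ys). cylindric_partition a b (xs, ys) \<and> length xs \<le> n \<and> length ys \<le> n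
                \<and> sum_list xs + sum_list ys = m}))"


lemma even_rhs_exp: "even (r * ((2 * int k + 1) * r + 2 * int k - 2 * int i + 1))"
  by auto

lemma rhs_exponent:
  "(of_int (rhs_exp k i r) :: rat) =
     of_int r * ((2 * of_nat k + 1) * of_int r + 2 * of_nat k - 2 * of_nat i + 1) / 2"
proof -
  have "2 * rhs_exp k i r = r * ((2 * int k + 1) * r + 2 * int k - 2 * int i + 1)"
    unfolding rhs_exp_def by (rule dvd_mult_div_cancel[OF even_rhs_exp])
  then have "of_int (2 * rhs_exp k i r) =
      (of_int (r * ((2 * int k + 1) * r + 2 * int k - 2 * int i + 1)) :: rat)"
    by simp
  then show ?thesis by simp
qed

lemma rhs_exp_nonneg:
  assumes "1 \<le> i" "i \<le> k"
  shows "rhs_exp k i r \<ge> 0"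
proof -
  have "r * ((2 * int k + 1) * r + 2 * int k - 2 * int i + 1) \<ge> 0"
  proof (cases "r \<ge> 0")
    case True
    then have "(2 * int k + 1) * r \<ge> 0" by simp
    then have "(2 * int k + 1) * r + 2 * int k - 2 * int i + 1 \<ge> 0" using assms by linarith
    with True show ?thesis by (rule mult_nonneg_nonneg)
  next
    case False
    then have "(2 * int k + 1) * r \<le> (2 * int k + 1) * (- 1)" by (intro mult_left_mono) auto
    also have "\<dots> = - 2 * int k - 1" by simp
    finally have "(2 * int k + 1) * r \<le> - 2 * int k - 1" .
    then have "(2 * int k + 1) * r + 2 * int k - 2 * int i + 1 \<le> 0" using assms by linarith
    with False show ?thesis by (intro mult_nonpos_nonpos) auto
  qed
  then show ?thesis unfolding rhs_exp_def by simp
qed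

lemma rhs_idx_even: "rhs_idx k i n (2 * t) = int n - (2 * int k + 1) * t"
proof -
  have "(2 * int k - 2 * int i + 1) * (neg_one_pow (2 * t) - 1) - 2 * (2 * int k + 1) * (2 * t)
        = (- ((2 * int k + 1) * t)) * 4"
    by (simp add: neg_one_pow_def algebra_simps)
  then show ?thesis
    unfolding rhs_idx_def by (simp only: nonzero_mult_div_cancel_right)
qed

lemma rhs_idx_odd:
  "rhs_idx k i n (2 * t + 1) = int n - ((2 * int k + 1) * t + 2 * int k - int i + 1)"
proof -
  have "(2 * int k - 2 * int i + 1) * (neg_one_pow (2 * t + 1) - 1)
          - 2 * (2 * int k + 1) * (2 * t + 1)
        = (- ((2 * int k + 1) * t + 2 * int k - int i + 1)) * 4"
    by (simp add: neg_one_pow_def algebra_simps)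
  then show ?thesis
    unfolding rhs_idx_def by (simp only: nonzero_mult_div_cancel_right)
qed

lemma rhs_index:
  "(of_int (rhs_idx k i n r) :: rat) =
     of_nat n - (2 * of_nat k + 1) * of_int r / 2
     + (2 * of_nat k - 2 * of_nat i + 1) * ((neg_one_pow r - 1) / 4)"
proof (cases "even r")
  case True
  then obtain t where "r = 2 * t" by (elim evenE)
  then show ?thesis by (simp add: rhs_idx_even neg_one_pow_def)
next
  case False
  then obtain t where "r = 2 * t + 1" by (elim oddE)
  then show ?thesis
    by (simp only: rhs_idx_odd) (simp add: neg_one_pow_def field_simps)
qed

lemma finite_support_rhs: "finite {r. rhs_term k i n r \<noteq> 0}"
proof (rule finite_subset)
  define B where "B = int n + 2 * int k + int i + 1"
  show "{r. rhs_term k i n r \<noteq> 0} \<subseteq> {- 2 * B - 1 .. 2 * B + 1}"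
  proof
    fix r assume "r \<in> {r. rhs_term k i n r \<noteq> 0}"
    then have "qbinom (2 * int n) (rhs_idx k i n r) \<noteq> 0"
      by (auto simp: rhs_term_def)
    then have b: "0 \<le> rhs_idx k i n r" "rhs_idx k i n r \<le> 2 * int n"
      by (auto simp: qbinom_def split: if_splits)
    define t where "t = r div 2"
    have r: "r = 2 * t \<or> r = 2 * t + 1" unfolding t_def by presburger
    then have "\<bar>(2 * int k + 1) * t\<bar> \<le> B"
      using b unfolding B_def by (auto simp: rhs_idx_even rhs_idx_odd)
    moreover have "\<bar>(2 * int k + 1) * t\<bar> \<ge> 1 * \<bar>t\<bar>"
      unfolding abs_mult by (intro mult_right_mono) auto
    ultimately show "r \<in> {- 2 * B - 1 .. 2 * B + 1}" using r by auto
  qed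
qed simp

lemma finite_support_lhs: "finite {\<nu> \<in> tuples k. lhs_term k i n \<nu> \<noteq> 0}"
proof (rule finite_subset)
  show "{\<nu> \<in> tuples k. lhs_term k i n \<nu> \<noteq> 0} \<subseteq>
          {\<nu>. \<forall>j. (j \<in> {1..<k} \<longrightarrow> \<nu> j \<in> {..n}) \<and> (j \<notin> {1..<k} \<longrightarrow> \<nu> j = 0)}"
  proof
    fix \<nu> assume "\<nu> \<in> {\<nu> \<in> tuples k. lhs_term k i n \<nu> \<noteq> 0}"
    then have zero: "\<And>j. j \<notin> {1..<k} \<Longrightarrow> \<nu> j = 0"
      and dec: "\<And>j. j \<in> {1..<k} \<Longrightarrow> \<nu> (j + 1) \<le> \<nu> j" and nz: "lhs_term k i n \<nu> \<noteq> 0"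
      unfolding tuples_def by blast+
    have "\<nu> m \<le> n" for m
    proof (rule ccontr)
      assume "\<not> \<nu> m \<le> n"
      then have big: "\<nu> m > n" by simp
      define J where "J = Max {j \<in> {1..<k}. \<nu> j > n}"
      have m: "m \<in> {j \<in> {1..<k}. \<nu> j > n}" using big zero[of m] by fastforce
      have "J \<in> {j \<in> {1..<k}. \<nu> j > n}"
        unfolding J_def by (rule Max_in) (use m in auto)
      then have J: "J \<in> {1..<k}" "\<nu> J > n" by auto
      have "\<not> \<nu> (J + 1) > n"
      proof
        assume a: "\<nu> (J + 1) > n"
        then have "J + 1 \<in> {j \<in> {1..<k}. \<nu> j > n}" using zero[of "J + 1"] by fastforce
        then have "J + 1 \<le> J" unfolding J_def by (intro Max_ge) auto
        then show False by simp
      qed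
      then have lt: "\<nu> (J + 1) < \<nu> J" using J by simp
      let ?a = "2 * int n - 2 * (\<Sum>l\<in>{1..<J}. int (\<nu> l)) - int (\<nu> J) - int (\<nu> (J + 1))
                   - 2 * alpha i J"
      have "qbinom' ?a (int (\<nu> J) - int (\<nu> (J + 1))) \<noteq> 0"
        using nz J(1) unfolding lhs_term_def by auto
      then have "int (\<nu> J) - int (\<nu> (J + 1)) \<le> ?a"
        using lt unfolding qbinom'_def qbinom_def by (auto split: if_splits)
      moreover have "(\<Sum>l\<in>{1..<J}. int (\<nu> l)) \<ge> 0" by (intro sum_nonneg) simp
      moreover have "alpha i J \<ge> 0" by (simp add: alpha_def)
      ultimately show False using J(2) by linarith
    qed
    with zero show "\<nu> \<in> {\<nu>. \<forall>j. (j \<in> {1..<k} \<longrightarrow> \<nu> j \<in> {..n}) \<and> (j \<notin> {1..<k} \<longrightarrow> \<nu> j = 0)}"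
      by auto
  qed
qed (rule finite_set_of_finite_funs; simp)

lemma infsum_lhs:
  "infsum (lhs_term k i n) (tuples k) = sum (lhs_term k i n) {\<nu> \<in> tuples k. lhs_term k i n \<nu> \<noteq> 0}"
proof -
  have "infsum (lhs_term k i n) (tuples k) =
        infsum (lhs_term k i n) {\<nu> \<in> tuples k. lhs_term k i n \<nu> \<noteq> 0}"
    by (rule infsum_cong_neutral) auto
  then show ?thesis by (simp add: infsum_finite[OF finite_support_lhs])
qed

lemma infsum_rhs:
  "infsum (rhs_term k i n) UNIV = sum (rhs_term k i n) {r. rhs_term k i n r \<noteq> 0}"
proof -
  have "infsum (rhs_term k i n) UNIV = infsum (rhs_term k i n) {r. rhs_term k i n r \<noteq> 0}"
    by (rule infsum_cong_neutral) auto
  then show ?thesis by (simp add: infsum_finite[OF finite_support_rhs])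
qed

lemma finite_CP:
  "finite {(xs, ys). cylindric_partition a b (xs, ys) \<and> length xs \<le> n \<and> length ys \<le> n
             \<and> sum_list xs + sum_list ys = m}"
proof (rule finite_subset)
  let ?L = "{xs. set xs \<subseteq> {..m} \<and> length xs \<le> n}"
  show "finite (?L \<times> ?L)" by (intro finite_cartesian_product finite_lists_length_le) auto
  show "{(xs, ys). cylindric_partition a b (xs, ys) \<and> length xs \<le> n \<and> length ys \<le> n
             \<and> sum_list xs + sum_list ys = m} \<subseteq> ?L \<times> ?L"
    using member_le_sum_list by fastforce
qed

lemma CP_0: "CP a b 0 = 1"
proof (rule fps_ext)
  fix m
  have "{(xs, ys). cylindric_partition a b (xs, ys) \<and> length xs \<le> 0 \<and> length ys \<le> 0
             \<and> sum_list xs + sum_list ys = m} = (if m = 0 then {([], [])} else {})"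
    by (auto simp: cylindric_partition_def is_partition_def part_def)
  then show "fps_nth (CP a b 0) m = fps_nth 1 m" by (simp add: CP_def)
qed

end

theory Submission
  imports Defs "HOL-Computational_Algebra.Formal_Laurent_Series"
begin

text \<open>
  Write \<open>B(L,M;a,b) = [L+M+a-b, M-b] [L+M-a+b, M+b]\<close> (Gaussian binomials). The q-Saalschuetz sum gives the
  Burge transform \<open>\<Sum>\<^sub>r q^(r^2) [2L+M-r, 2L] B(L-r,r;a,b) = q^(b^2) B(L,M;a+b,b)\<close>, whose binomial is the
  factor \<open>[2n - 2(n\<^sub>1+\<dots>+n\<^sub>j\<^sub>-\<^sub>1) - n\<^sub>j - n\<^sub>j\<^sub>+\<^sub>1, n\<^sub>j - n\<^sub>j\<^sub>+\<^sub>1]\<close> of the left-hand side. Starting from a telescoping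
  alternating sum, two Burge steps evaluate the innermost binomial. The variables \<open>n\<^sub>j\<close> with \<open>j \<ge> i\<close>, which
  carry the extra \<open>q^(n\<^sub>j)\<close>, correspond to a modified transform (the half step) that is valid after summing
  over \<open>t\<close> and \<open>- t\<close>; those with \<open>j < i\<close> to ordinary Burge steps, and the sum over \<open>n\<^sub>1\<close> to the limit
  \<open>M \<rightarrow> \<infinity>\<close>.

  For cylindric partitions let \<open>H(a,b)\<close> count those with at most \<open>a\<close> and \<open>b\<close> parts. Removing a full first
  column gives \<open>(1 - q^(a+b)) H(a,b) = H(a-1,b) + H(a,b-1) - H(a-1,b-1)\<close> in the strip
  \<open>- c\<^sub>2 \<le> a - b \<le> c\<^sub>1\<close>, with \<open>H(a,b) = H(a,b-1)\<close> and \<open>H(a,b) = H(a-1,b)\<close> just outside of it. The shifts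
  \<open>1/((q;q)\<^sub>a\<^sub>+\<^sub>s (q;q)\<^sub>b\<^sub>-\<^sub>s)\<close> solve the recurrence, and the alternating sum solves the boundary conditions.
\<close>

section \<open>Gaussian binomials and the q-Saalschuetz sum\<close>

text \<open>A field, because the exponents below range over all integers and \<open>qfac\<close> is
  inverted. The intended instance is the indeterminate of the rational Laurent series.\<close>

locale q_base =
  fixes x :: "'a::field"
  assumes x_nonzero: "x \<noteq> 0" and x_not_root_of_unity: "n > 0 \<Longrightarrow> x ^ n \<noteq> 1"
begin

text \<open>The value 0 at negative arguments combines with \<open>inverse 0 = 0\<close> to give
  1/(q;q)_m = 0 for m < 0, so \<open>qbin\<close> vanishes outside 0 \<le> b \<le> a without a case
  distinction.\<close>

definition qfac :: "int \<Rightarrow> 'a" where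
  "qfac m = (if m < 0 then 0 else \<Prod>j<nat m. 1 - x ^ Suc j)"

definition qbin :: "int \<Rightarrow> int \<Rightarrow> 'a" where
  "qbin a b = qfac a / (qfac b * qfac (a - b))"

lemma powi_add: "x powi a * x powi b = x powi (a + b)"
  using x_nonzero by (simp add: power_int_add)

lemma qfac_neg [simp]: "m < 0 \<Longrightarrow> qfac m = 0"
  by (simp add: qfac_def)

lemma qfac_0 [simp]: "qfac 0 = 1"
  by (simp add: qfac_def)

lemma powi_ne_1: "m > 0 \<Longrightarrow> x powi m \<noteq> 1"
  using x_not_root_of_unity[of "nat m"] by (simp add: power_int_nonneg_exp)

lemma qfac_nonzero [simp]: "qfac m = 0 \<longleftrightarrow> m < 0"
  using x_not_root_of_unity[of "Suc _"] by (auto simp: qfac_def)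

lemma qfac_rec:
  assumes "m \<noteq> 0"
  shows "qfac m = (1 - x powi m) * qfac (m - 1)"
proof (cases "m < 0")
  case False
  then obtain n where "m = int (Suc n)" using assms
    by (metis not_less nonneg_int_cases not0_implies_Suc of_nat_0)
  then show ?thesis
    by (simp add: qfac_def nat_add_distrib power_int_add x_nonzero mult.commute add.commute[of 1])
qed simp

text \<open>Unlike \<open>qfac_rec\<close> this has no exceptional point: at \<open>m = 0\<close>
  the factor \<open>1 - x powi m\<close> vanishes, in accordance with
  \<open>inverse (qfac (- 1)) = 0\<close>.\<close>

lemma inverse_qfac_rec: "inverse (qfac (m - 1)) = (1 - x powi m) * inverse (qfac m)"
proof (cases "m > 0")
  case True
  then show ?thesis using qfac_rec[of m] powi_ne_1[of m] by (simp add: field_simps)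
next
  case False
  then show ?thesis by (cases "m = 0") auto
qed

lemma qbin_inverse: "qbin a b = qfac a * inverse (qfac b) * inverse (qfac (a - b))"
  by (simp add: qbin_def divide_inverse)

lemma qbin_eq_0 [simp]: "b < 0 \<or> b > a \<Longrightarrow> qbin a b = 0"
  by (auto simp: qbin_def)

lemma qbin_eq_0_iff: "qbin a b = 0 \<longleftrightarrow> b < 0 \<or> b > a"
  by (auto simp: qbin_def)

lemma qbin_0_right [simp]: "a \<ge> 0 \<Longrightarrow> qbin a 0 = 1"
  by (simp add: qbin_def)

lemma qbin_self [simp]: "a \<ge> 0 \<Longrightarrow> qbin a a = 1"
  by (simp add: qbin_def)

lemma qbin_sym: "qbin a b = qbin a (a - b)"
  by (simp add: qbin_def mult.commute)

text \<open>From 1 - x^a = (1 - x^b) + x^b (1 - x^(a-b)). At \<open>a = b = 0\<close> the left side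
  is 1 while both binomials on the right have top -1; every use must avoid this point.\<close>

lemma qbin_pascal:
  assumes "\<not> (a = 0 \<and> b = 0)"
  shows "qbin a b = qbin (a - 1) (b - 1) + x powi b * qbin (a - 1) b"
proof (cases "a = 0")
  case False
  have *: "a - 1 - b = a - b - 1" by simp
  have p: "x powi a = x powi b * x powi (a - b)" by (simp add: powi_add)
  show ?thesis
    unfolding qbin_inverse * qfac_rec[OF False] inverse_qfac_rec p
    by (simp add: inverse_qfac_rec algebra_simps)
next
  case True
  then show ?thesis using assms by (cases "b < 0") auto
qed

lemma qbin_pascal':
  assumes "\<not> (a = 0 \<and> b = 0)"
  shows "qbin a b = qbin (a - 1) b + x powi (a - b) * qbin (a - 1) (b - 1)"
proof -
  have "qbin a (a - b) = qbin (a - 1) (a - b - 1) + x powi (a - b) * qbin (a - 1) (a - b)"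
    using assms by (intro qbin_pascal) auto
  then show ?thesis
    using qbin_sym[of a b] qbin_sym[of "a - 1" b] qbin_sym[of "a - 1" "b - 1"]
      by (simp add: algebra_simps)
qed

lemma qbin_trinomial: "qbin a b * qbin b c = qbin a c * qbin (a - c) (b - c)"
  by (auto simp: qbin_def)

text \<open>Induction on \<open>a\<close> by \<open>qbin_pascal'\<close>. The second Pascal term is
  the same sum shifted by j \<mapsto> j - 1, so \<open>k\<close> and the index set \<open>S\<close>
  have to vary.\<close>

lemma q_Vandermonde:
  assumes "a \<ge> 0" "b \<ge> 0" "finite S" "{0..a} \<subseteq> S"
  shows "(\<Sum>j\<in>S. x powi (j * (b - k + j)) * qbin a j * qbin b (k - j)) = qbin (a + b) k"
  using assms(1,3,4)
proof (induction a arbitrary: k S rule: int_ge_induct)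
  case base
  have "(\<Sum>j\<in>S. x powi (j * (b - k + j)) * qbin 0 j * qbin b (k - j)) =
      (\<Sum>j\<in>{0}. x powi (j * (b - k + j)) * qbin 0 j * qbin b (k - j))"
    using base by (intro sum.mono_neutral_right) (auto simp: qbin_eq_0_iff)
  then show ?case by simp
next
  case (step a)
  have sub: "{0..a} \<subseteq> S" "{0..a} \<subseteq> (\<lambda>j. j - 1) ` S"
    using step.prems by (force intro: image_eqI[where x = "_ + 1"])+
  have split: "x powi (j * (b - k + j)) * qbin (a + 1) j * qbin b (k - j) =
      x powi (j * (b - k + j)) * qbin a j * qbin b (k - j) +
      x powi (a + b + 1 - k) * (x powi ((j - 1) * (b - (k - 1) + (j - 1))) * qbin a (j - 1) *
        qbin b (k - 1 - (j - 1)))"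
    for j
  proof -
    have e: "x powi (j * (b - k + j)) * x powi (a + 1 - j) =
        x powi (a + b + 1 - k) * x powi ((j - 1) * (b - (k - 1) + (j - 1)))"
      unfolding powi_add by (rule arg_cong[where f = "power_int x"]) (simp add: algebra_simps)
    have "qbin (a + 1) j = qbin a j + x powi (a + 1 - j) * qbin a (j - 1)"
      using qbin_pascal'[of "a + 1" j] step.hyps by simp
    then show ?thesis using e
      by (simp add: distrib_left distrib_right)
  qed
  have "(\<Sum>j\<in>S. x powi (j * (b - k + j)) * qbin (a + 1) j * qbin b (k - j)) =
     (\<Sum>j\<in>S. x powi (j * (b - k + j)) * qbin a j * qbin b (k - j)) +
     x powi (a + b + 1 - k) * (\<Sum>j\<in>(\<lambda>j. j - 1) ` S. x powi (j * (b - (k - 1) + j)) * qbin a j *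
       qbin b (k - 1 - j))"
    unfolding split sum.distrib sum_distrib_left[symmetric]
    by (subst sum.reindex) (auto simp: inj_on_def o_def)
  also have "\<dots> = qbin (a + b) k + x powi (a + b + 1 - k) * qbin (a + b) (k - 1)"
    using step.IH[of S k] step.IH[of "(\<lambda>j. j - 1) ` S" "k - 1"] sub step.prems by simp
  also have "\<dots> = qbin (a + 1 + b) k"
    using qbin_pascal'[of "a + b + 1" k] step.hyps assms(2) by (simp add: algebra_simps)
  finally show ?case .
qed

lemma q_Vandermonde':
  assumes "a \<ge> 0" "b \<ge> 0" "finite S" "{0..a} \<subseteq> S"
  shows "(\<Sum>j\<in>S. x powi ((a - j) * (k - j)) * qbin a j * qbin b (k - j)) = qbin (a + b) k"
proof -
  let ?f = "\<lambda>j. x powi ((a - j) * (k - j)) * qbin a j * qbin b (k - j)"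
  \<comment> \<open>The image of the enlarged set under j \<mapsto> k - j contains {0..b}; this
    reflection exchanges the roles of \<open>a\<close> and \<open>b\<close>.\<close>
  have "sum ?f S = sum ?f (S \<union> {k - b..k})"
    using assms by (intro sum.mono_neutral_left) (force simp: qbin_eq_0_iff subset_eq)+
  also have "\<dots> = (\<Sum>j\<in>(\<lambda>j. k - j) ` (S \<union> {k - b..k}). ?f (k - j))"
    by (subst sum.reindex) (auto simp: inj_on_def)
  also have "\<dots> = (\<Sum>j\<in>(\<lambda>j. k - j) ` (S \<union> {k - b..k}). x powi (j * (a - k + j)) * qbin b j *
    qbin a (k - j))"
    by (intro sum.cong) (auto simp: algebra_simps)
  also have "\<dots> = qbin (b + a) k"
    using assms by (intro q_Vandermonde) (force intro: image_eqI[where x = "k - _"])+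
  finally show ?thesis by (simp add: add.commute)
qed

text \<open>Three summations: the third binomial is expanded by \<open>q_Vandermonde\<close>; after
  a trinomial revision the sum over \<open>r\<close> is closed by \<open>q_Vandermonde'\<close>; a
  second revision extracts a factor free of \<open>s\<close>, and \<open>q_Vandermonde\<close>
  closes the sum over \<open>s\<close>.\<close>

lemma q_Saalschuetz_aux:
  assumes "a \<ge> 0" "b \<ge> 0" "finite S" "{0..a} \<subseteq> S"
  shows "(\<Sum>r\<in>S. x powi (r * (r + c)) * qbin a r * qbin b (r + c) * qbin (a + b + m - r) (m - r)) =
    qbin (a + m + c) m * qbin (b + m) (m + c)"
proof (cases "m \<ge> 0")
  case False
  then have "x powi (r * (r + c)) * qbin a r * qbin b (r + c) * qbin (a + b + m - r) (m - r) =
    0" for r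
    by (cases "r < 0") auto
  then show ?thesis using False by (simp only:) simp
next
  case True
  let ?I = "{0..a}"
  have "(\<Sum>r\<in>S. x powi (r * (r + c)) * qbin a r * qbin b (r + c) * qbin (a + b + m - r) (m - r)) =
    (\<Sum>r\<in>?I. x powi (r * (r + c)) * qbin a r * qbin b (r + c) * qbin (a + b + m - r) (m - r))"
    using assms by (intro sum.mono_neutral_right) (auto simp: qbin_eq_0_iff)
  also have "\<dots> = (\<Sum>r\<in>?I. \<Sum>s\<in>?I. x powi (s * (s + c)) * qbin a s * qbin (b + m) (m - s) *
      (x powi ((s - r) * (b - c - r)) * qbin s r * qbin b (b - c - r)))"
  proof (intro sum.cong refl)
    fix r assume r: "r \<in> ?I"
    have "qbin (a + b + m - r) (m - r) = qbin ((a - r) + (b + m)) (m - r)"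
      by (simp add: algebra_simps)
    also have "\<dots> = (\<Sum>j\<in>(\<lambda>s. s - r) ` ?I. x powi (j * (b + m - (m - r) + j)) * qbin (a - r) j *
      qbin (b + m) (m - r - j))"
      using r assms True by (intro q_Vandermonde[symmetric]) (force intro: image_eqI[where x =
        "_ + r"])+
    also have "\<dots> = (\<Sum>s\<in>?I. x powi ((s - r) * (b + s)) * qbin (a - r) (s - r) *
      qbin (b + m) (m - s))"
      by (subst sum.reindex) (auto simp: inj_on_def algebra_simps)
    finally have "x powi (r * (r + c)) * qbin a r * qbin b (r + c) * qbin (a + b + m - r) (m - r) =
        (\<Sum>s\<in>?I. x powi (r * (r + c)) * x powi ((s - r) * (b + s)) *
          (qbin a r * qbin (a - r) (s - r)) * qbin b (r + c) * qbin (b + m) (m - s))"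
      by (simp add: sum_distrib_left mult_ac)
    also have "\<dots> = (\<Sum>s\<in>?I. x powi (s * (s + c)) * x powi ((s - r) * (b - c - r)) *
      (qbin a s * qbin s r) * qbin b (b - c - r) * qbin (b + m) (m - s))"
    proof (intro sum.cong refl)
      fix s
      have "x powi (r * (r + c)) * x powi ((s - r) * (b + s)) = x powi (s * (s + c)) *
        x powi ((s - r) * (b - c - r))"
        unfolding powi_add by (rule arg_cong[where f = "power_int x"]) (simp add: algebra_simps)
      moreover have "qbin b (r + c) = qbin b (b - c - r)"
        using qbin_sym[of b "r + c"] by (simp add: algebra_simps)
      ultimately show "x powi (r * (r + c)) * x powi ((s - r) * (b + s)) *
        (qbin a r * qbin (a - r) (s - r)) * qbin b (r + c) * qbin (b + m) (m - s) =
         x powi (s * (s + c)) * x powi ((s - r) * (b - c - r)) * (qbin a s * qbin s r) *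
           qbin b (b - c - r) * qbin (b + m) (m - s)"
        by (simp only: qbin_trinomial)
    qed
    finally show "x powi (r * (r + c)) * qbin a r * qbin b (r + c) * qbin (a + b + m - r) (m - r) =
      (\<Sum>s\<in>?I. x powi (s * (s + c)) * qbin a s * qbin (b + m) (m - s) *
      (x powi ((s - r) * (b - c - r)) * qbin s r * qbin b (b - c - r)))"
      by (simp add: mult_ac)
  qed
  also have "\<dots> = (\<Sum>s\<in>?I. x powi (s * (s + c)) * qbin a s * qbin (b + m) (m - s) *
    qbin (s + b) (b - c))"
  proof (subst sum.swap, intro sum.cong refl)
    fix s assume s: "s \<in> ?I"
    have "(\<Sum>r\<in>?I. x powi ((s - r) * (b - c - r)) * qbin s r * qbin b (b - c - r)) =
      qbin (s + b) (b - c)"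
      using s assms by (intro q_Vandermonde') auto
    then show "(\<Sum>r\<in>?I. x powi (s * (s + c)) * qbin a s * qbin (b + m) (m - s) *
      (x powi ((s - r) * (b - c - r)) * qbin s r * qbin b (b - c - r))) =
      x powi (s * (s + c)) * qbin a s * qbin (b + m) (m - s) * qbin (s + b) (b - c)"
      by (simp add: sum_distrib_left[symmetric])
  qed
  also have "\<dots> = (\<Sum>s\<in>?I. x powi (s * (m + c - m + s)) * qbin a s * qbin (m + c) (m - s)) *
    qbin (b + m) (m + c)"
    unfolding sum_distrib_right
  proof (intro sum.cong refl)
    fix s
    have "qbin (b + m) (m - s) * qbin (s + b) (b - c) = qbin (b + m) (b + s) * qbin (b + s) (b - c)"
      using qbin_sym[of "b + m" "m - s"] by (simp add: algebra_simps)
    also have "\<dots> = qbin (b + m) (b - c) * qbin (m + c) (s + c)"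
      by (simp add: qbin_trinomial algebra_simps)
    also have "\<dots> = qbin (b + m) (m + c) * qbin (m + c) (m - s)"
      using qbin_sym[of "b + m" "b - c"] qbin_sym[of "m + c" "s + c"] by (simp add: algebra_simps)
    finally show "x powi (s * (s + c)) * qbin a s * qbin (b + m) (m - s) * qbin (s + b) (b - c) =
       x powi (s * (m + c - m + s)) * qbin a s * qbin (m + c) (m - s) * qbin (b + m) (m + c)"
      by (simp add: algebra_simps)
  qed
  also have "\<dots> = qbin (a + m + c) m * qbin (b + m) (m + c)"
  \<comment> \<open>For \<open>m + c < 0\<close> the extracted factor
    \<open>qbin (b + m) (m + c)\<close> is 0 on both sides.\<close>
  proof (cases "m + c \<ge> 0")
    case True
    then show ?thesis using q_Vandermonde[of a "m + c" "{0..a}" m] assms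
      by (simp add: algebra_simps)
  qed simp
  finally show ?thesis .
qed

text \<open>
  A Gaussian binomial with negative top is 0 here,
    so the polynomial identity fails for some negative
  \<open>a\<close> or \<open>b\<close>; the hypothesis excludes exactly the cases where the right-hand side would not vanish.
\<close>

lemma q_Saalschuetz:
  assumes "a \<ge> 0 \<and> b \<ge> 0 \<or> a + 2 * B < 0 \<or> b - 2 * B < 0"
  shows "(\<Sum>r\<in>{0..M}. x powi (r\<^sup>2 - B\<^sup>2) * qbin a (r - B) * qbin b (r + B) *
    qbin (a + b + M - r) (a + b)) =
    qbin (a + M + B) (M - B) * qbin (b + M - B) (M + B)"
proof (cases "a \<ge> 0 \<and> b \<ge> 0")
  case False
  then have z: "qbin a i * qbin b j = 0" for i j by (auto simp: qbin_eq_0_iff)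
  have "x powi (r\<^sup>2 - B\<^sup>2) * qbin a (r - B) * qbin b (r + B) * qbin (a + b + M - r) (a + b) =
    0" for r
    using z[of "r - B" "r + B"] by auto
  moreover have "qbin (a + M + B) (M - B) * qbin (b + M - B) (M + B) = 0"
    using assms False by (auto simp: qbin_eq_0_iff)
  ultimately show ?thesis by (simp only: sum.neutral_const)
next
  case True
  let ?f = "\<lambda>r. x powi (r\<^sup>2 - B\<^sup>2) * qbin a (r - B) * qbin b (r + B) * qbin (a + b + M - r) (a + b)"
  \<comment> \<open>The second interval is the support of \<open>qbin a (r - B)\<close>. Its points
    above \<open>M\<close> are killed by the last binomial, and those below 0 satisfy B \<le> r < 0,
    hence \<open>r + B < 0\<close>.\<close>
  let ?S = "{0..M} \<union> {B..a + B}"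
  have "sum ?f {0..M} = sum ?f ?S"
    by (intro sum.mono_neutral_left) (auto simp: qbin_eq_0_iff)
  also have "\<dots> = (\<Sum>r\<in>(\<lambda>r. r - B) ` ?S. ?f (r + B))"
    by (subst sum.reindex) (auto simp: inj_on_def add.commute[of B])
  also have "\<dots> = (\<Sum>r\<in>(\<lambda>r. r - B) ` ?S. x powi (r * (r + 2 * B)) * qbin a r * qbin b (r + 2 * B) *
      qbin (a + b + (M - B) - r) (M - B - r))"
  proof (intro sum.cong refl)
    fix r
    have e: "(r + B)\<^sup>2 - B\<^sup>2 = r * (r + 2 * B)" by (simp add: power2_eq_square algebra_simps)
    show "?f (r + B) = x powi (r * (r + 2 * B)) * qbin a r * qbin b (r + 2 * B) *
      qbin (a + b + (M - B) - r) (M - B - r)"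
      unfolding e using qbin_sym[of "a + b + (M - B) - r" "M - B - r"] by (simp add: algebra_simps)
  qed
  also have "\<dots> = qbin (a + (M - B) + 2 * B) (M - B) * qbin (b + (M - B)) (M - B + 2 * B)"
    using True by (intro q_Saalschuetz_aux) (force intro: image_eqI[where x = "_ + B"])+
  finally show ?thesis by (simp add: algebra_simps)
qed

end

section \<open>The Burge transform\<close>

lemma sum_int_reflect: "(\<Sum>t\<in>{-N..N::int}. f t) = (\<Sum>t\<in>{-N..N}. f (- t))"
  by (rule sum.reindex_bij_witness[where i = uminus and j = uminus]) auto

lemma sum_int_telescope:
  fixes h :: "int \<Rightarrow> 'b::ab_group_add"
  assumes "a \<le> b + 1"
  shows "(\<Sum>t\<in>{a..b}. h t - h (t + 1)) = h a - h (b + 1)"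
  using assms
proof (induction "b + 1" arbitrary: b rule: int_ge_induct)
  case base
  then show ?case by simp
next
  case (step c b)
  then have "{a..b} = insert b {a..b - 1}" by auto
  then have "(\<Sum>t\<in>{a..b}. h t - h (t + 1)) = h b - h (b + 1) + (\<Sum>t\<in>{a..b - 1}. h t - h (t + 1))"
    by simp
  then show ?case using step.hyps(2)[of "b - 1"] step.hyps(1) step.hyps(3) by simp
qed

context q_base
begin

text \<open>Formally the limit M \<rightarrow> \<infinity> of \<open>q_Saalschuetz\<close>, obtained
  directly from \<open>q_Vandermonde\<close>. A nonzero term has 0 \<le> 2r \<le> a + b, so the
  bound on \<open>R\<close> makes {0..R} contain the support.\<close>

lemma q_Vandermonde_centred:
  assumes "a \<ge> 0 \<and> b \<ge> 0 \<or> a + 2 * B < 0 \<or> b - 2 * B < 0"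
    and "a + b \<le> 2 * R + 1"
  shows "(\<Sum>r\<in>{0..R}. x powi (r\<^sup>2 - B\<^sup>2) * qbin a (r - B) * qbin b (r + B)) =
    qbin (a + b) (b - 2 * B)"
proof (cases "a \<ge> 0 \<and> b \<ge> 0")
  case False
  then have z: "qbin a i * qbin b j = 0" for i j by (auto simp: qbin_eq_0_iff)
  have "x powi (r\<^sup>2 - B\<^sup>2) * qbin a (r - B) * qbin b (r + B) = 0" for r
    using z[of "r - B" "r + B"] by auto
  moreover have "qbin (a + b) (b - 2 * B) = 0"
    using assms False by (auto simp: qbin_eq_0_iff)
  ultimately show ?thesis by (simp only: sum.neutral_const)
next
  case True
  let ?f = "\<lambda>r. x powi (r\<^sup>2 - B\<^sup>2) * qbin a (r - B) * qbin b (r + B)"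
  let ?S = "{0..R} \<union> {B..a + B}"
  have "sum ?f {0..R} = sum ?f ?S"
    using assms(2) by (intro sum.mono_neutral_left) (auto simp: qbin_eq_0_iff)
  also have "\<dots> = (\<Sum>r\<in>(\<lambda>r. r - B) ` ?S. ?f (r + B))"
    by (subst sum.reindex) (auto simp: inj_on_def add.commute[of B])
  also have "\<dots> = (\<Sum>r\<in>(\<lambda>r. r - B) ` ?S. x powi (r * (b - (b - 2 * B) + r)) * qbin a r *
    qbin b (b - 2 * B - r))"
  proof (intro sum.cong refl)
    fix r
    have e: "(r + B)\<^sup>2 - B\<^sup>2 = r * (b - (b - 2 * B) + r)"
      by (simp add: power2_eq_square algebra_simps)
    show "?f (r + B) = x powi (r * (b - (b - 2 * B) + r)) * qbin a r * qbin b (b - 2 * B - r)"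
      unfolding e using qbin_sym[of b "b - 2 * B - r"] by (simp add: algebra_simps)
  qed
  also have "\<dots> = qbin (a + b) (b - 2 * B)"
    using True by (intro q_Vandermonde) (force intro: image_eqI[where x = "_ + B"])+
  finally show ?thesis .
qed

section \<open>Products of two Gaussian binomials and their transforms\<close>

definition bprod :: "int \<Rightarrow> int \<Rightarrow> int \<Rightarrow> int \<Rightarrow> 'a" where
  "bprod L M a b = qbin (L + M + a - b) (M - b) * qbin (L + M - a + b) (M + b)"

text \<open>The bottoms M - b and M + b add up to 2M, and the differences top minus bottom, L + a
  and L - a, add up to 2L; so one of a pair is negative.\<close>

lemma bprod_eq_0: "L < 0 \<or> M < 0 \<Longrightarrow> bprod L M a b = 0"
  by (auto simp: bprod_def qbin_eq_0_iff)

lemma bprod_swap: "bprod L M a b = bprod M L b a"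
  using qbin_sym[of "L + M + a - b" "M - b"] qbin_sym[of "L + M - a + b" "M + b"]
  by (simp add: bprod_def algebra_simps)

text \<open>The claim is that |a - b| \<le> L or L < |a + b|, and |a - b| \<le> |a + b| when
  \<open>a\<close> and \<open>b\<close> do not have opposite signs.\<close>

lemma burge_condition:
  fixes a b L :: int
  assumes "a * b \<ge> 0"
  shows "L + a - b \<ge> 0 \<and> L - a + b \<ge> 0 \<or>
    L + a - b + 2 * b < 0 \<or> L - a + b - 2 * b < 0"
  using assms by (auto simp: zero_le_mult_iff)

lemma powi_split: "x powi a = x powi b * x powi (a - b)"
  by (simp add: powi_add)

text \<open>In \<open>bprod (L - r) r a b\<close> the tops L + a - b and L - a + b are free of
  \<open>r\<close> and add up to 2L. Hence the kernel of \<open>q_Saalschuetz\<close> does not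
  depend on \<open>a\<close> and \<open>b\<close>, and the transform applies to linear
  combinations.\<close>

lemma burge:
  assumes "a * b \<ge> 0"
  shows "(\<Sum>r\<in>{0..M}. x powi r\<^sup>2 * qbin (2 * L + M - r) (2 * L) * bprod (L - r) r a b) =
    x powi b\<^sup>2 * bprod L M (a + b) b"
proof -
  have *: "L + a - b + (L - a + b) = 2 * L" by simp
  have "(\<Sum>r\<in>{0..M}. x powi r\<^sup>2 * qbin (2 * L + M - r) (2 * L) * bprod (L - r) r a b) =
     x powi b\<^sup>2 * (\<Sum>r\<in>{0..M}. x powi (r\<^sup>2 - b\<^sup>2) * qbin (L + a - b) (r - b) *
       qbin (L - a + b) (r + b) * qbin (2 * L + M - r) (2 * L))"
    unfolding sum_distrib_left
    by (intro sum.cong refl, subst powi_split[of "_" "b\<^sup>2"]) (simp add: bprod_def algebra_simps)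
  also have "\<dots> = x powi b\<^sup>2 * bprod L M (a + b) b"
    using q_Saalschuetz[OF burge_condition[OF assms, of L], of M, unfolded *]
    by (simp add: bprod_def algebra_simps)
  finally show ?thesis .
qed

lemma burge_limit:
  assumes "a * b \<ge> 0"
  shows "(\<Sum>r\<in>{0..L}. x powi r\<^sup>2 * bprod (L - r) r a b) = x powi b\<^sup>2 * qbin (2 * L) (L - (a + b))"
proof -
  have *: "L + a - b + (L - a + b) = 2 * L" by simp
  have "(\<Sum>r\<in>{0..L}. x powi r\<^sup>2 * bprod (L - r) r a b) =
     x powi b\<^sup>2 * (\<Sum>r\<in>{0..L}. x powi (r\<^sup>2 - b\<^sup>2) * qbin (L + a - b) (r - b) *
       qbin (L - a + b) (r + b))"
    unfolding sum_distrib_left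
    by (intro sum.cong refl, subst powi_split[of "_" "b\<^sup>2"]) (simp add: bprod_def algebra_simps)
  also have "\<dots> = x powi b\<^sup>2 * qbin (2 * L) (L - (a + b))"
    using q_Vandermonde_centred[OF burge_condition[OF assms, of L], of L, unfolded *]
    by (simp add: algebra_simps)
  finally show ?thesis .
qed

text \<open>After \<open>t \<mapsto> - t\<close> in the second term, one Pascal step on each side makes the sum telescope.\<close>

lemma burge_seed:
  assumes "L + M \<ge> 0" "N > L + M"
  shows "(\<Sum>t\<in>{-N..N}. x powi (t\<^sup>2 + t) * bprod L M t t - x powi (t\<^sup>2 - t) * bprod L M (t - 1) t) =
    (if L = 0 \<and> M = 0 then 1 else 0)" (is "?lhs = _")
\<comment> \<open>For \<open>L + M = 0\<close> Pascal could meet its excluded point, so the sum is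
  evaluated directly: only \<open>t = 0\<close> can contribute.\<close>
proof (cases "L + M = 0")
  case True
  then have LM: "L = - M" by simp
  have z: "bprod L M (t - 1) t = 0" for t
    using LM by (auto simp: bprod_def qbin_eq_0_iff)
  have z': "bprod L M t t = (if t = 0 \<and> M = 0 then 1 else 0)" for t
    using LM by (auto simp: bprod_def qbin_eq_0_iff)
  have "?lhs = (\<Sum>t\<in>{-N..N}. if t = 0 then (if M = 0 then 1 else 0) else 0)"
    by (intro sum.cong refl) (simp add: z z')
  also have "\<dots> = (if M = 0 then 1 else 0)"
    using assms by (simp add: sum.delta)
  finally show ?thesis using LM by simp
next
  case False
  define P where "P = L + M"
  have P: "P \<ge> 1" using False assms by (simp add: P_def)
  \<comment> \<open>What the two Pascal steps leave over: the mixed product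
    \<open>qbin P (M - t) * qbin (P - 1) (M + t)\<close> arises from both terms and cancels.\<close>
  define h where "h = (\<lambda>t. x powi (L + t\<^sup>2) * qbin P (M - t) * qbin (P - 1) (M + t - 1))"
  have "?lhs = (\<Sum>t\<in>{-N..N}. x powi (t\<^sup>2 + t) * bprod L M t t - x powi (t\<^sup>2 + t) *
    bprod L M (- t - 1) (- t))"
    unfolding sum_subtractf by (subst (2) sum_int_reflect) simp
  also have "\<dots> = (\<Sum>t\<in>{-N..N}. h t - h (t + 1))"
  proof (intro sum.cong refl)
    fix t
    have 1: "qbin P (M + t) = qbin (P - 1) (M + t) + x powi (L - t) * qbin (P - 1) (M + t - 1)"
      using qbin_pascal'[of P "M + t"] P by (simp add: P_def algebra_simps)
    have 2: "qbin (P + 1) (M - t) = qbin P (M - t) + x powi (L + t + 1) * qbin P (M - t - 1)"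
      using qbin_pascal'[of "P + 1" "M - t"] P by (simp add: P_def algebra_simps)
    have b: "bprod L M t t = qbin P (M - t) * qbin P (M + t)"
      "bprod L M (- t - 1) (- t) = qbin (P - 1) (M + t) * qbin (P + 1) (M - t)"
      by (simp_all add: bprod_def P_def algebra_simps)
    have e: "x powi (L + t\<^sup>2) = x powi (t\<^sup>2 + t) * x powi (L - t)"
      "x powi (L + (t + 1)\<^sup>2) = x powi (t\<^sup>2 + t) * x powi (L + t + 1)"
      unfolding powi_add by (rule arg_cong[where f =
        "power_int x"]; simp add: power2_eq_square algebra_simps)+
    show "x powi (t\<^sup>2 + t) * bprod L M t t - x powi (t\<^sup>2 + t) * bprod L M (- t - 1) (- t) = h t -
      h (t + 1)"
      unfolding b 1 2 h_def e by (simp add: algebra_simps)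
  qed
  also have "\<dots> = h (- N) - h (N + 1)"
    using assms by (intro sum_int_telescope) auto
  also have "\<dots> = 0"
  proof -
    have "h (- N) = 0" "h (N + 1) = 0"
      using assms by (auto simp: h_def qbin_eq_0_iff P_def)
    then show ?thesis by simp
  qed
  finally show ?thesis using False by auto
qed

text \<open>
  All sums over \<open>t \<in> \<int>\<close> are truncated to \<open>{-N..N}\<close>: the transforms act term by term and only use the
  symmetry \<open>t \<mapsto> - t\<close>, so that no bound on \<open>N\<close> is needed except for the seed.
\<close>

definition bos :: "int \<Rightarrow> int \<Rightarrow> int \<Rightarrow> int \<Rightarrow> int \<Rightarrow> 'a" where
  "bos N K i L M = (\<Sum>t\<in>{-N..N}.
     x powi (t * (2 * K * t + K - 2 * i)) * bprod L M (K * t) (2 * t) -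
     x powi ((2 * t - 1) * (K * t - i)) * bprod L M (K * t - i) (2 * t - 1))"

text \<open>For \<open>K = 2 * k + 1\<close> the two summands are, up to sign, the terms r = 2t and
  r = 2t - 1 of the right-hand side of the theorem.\<close>

definition bos_limit :: "int \<Rightarrow> int \<Rightarrow> int \<Rightarrow> int \<Rightarrow> 'a" where
  "bos_limit N K i L = (\<Sum>t\<in>{-N..N}.
     x powi (t * (2 * K * t + K - 2 * i)) * qbin (2 * L) (L - K * t) -
     x powi ((2 * t - 1) * (K * t - i)) * qbin (2 * L) (L - (K * t - i)))"

lemma bos_eq_0: "L < 0 \<or> M < 0 \<Longrightarrow> bos N K i L M = 0"
  by (simp add: bos_def bprod_eq_0)

text \<open>The sign hypothesis of \<open>burge\<close> for the odd terms: both factors are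
  nonnegative for t \<ge> 1 and nonpositive for t \<le> 0.\<close>

lemma mult_affine_nonneg: "0 \<le> i \<Longrightarrow> i \<le> K \<Longrightarrow> 0 \<le> (K * t - i) * (2 * t - 1)" for t :: int
proof (cases "t \<ge> 1")
  case True
  assume "0 \<le> i" "i \<le> K"
  moreover have "K * t \<ge> K * 1" using True calculation by (intro mult_left_mono) auto
  ultimately show ?thesis using True by simp
next
  case False
  assume "0 \<le> i" "i \<le> K"
  moreover have "K * t \<le> K * 0" using False calculation by (intro mult_left_mono) auto
  ultimately show ?thesis using False by (intro mult_nonpos_nonpos) auto
qed

text \<open>\<open>burge\<close> term by term: Kt + 2t = (K+2)t and (Kt - i) + (2t - 1) = (K+2)t -
  (i+1), while the new factors x^((2t)^2) and x^((2t-1)^2) turn the exponents into those for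
  \<open>K + 2\<close> and \<open>i + 1\<close>.\<close>

lemma bos_burge:
  assumes "0 \<le> i" "i \<le> K"
  shows "(\<Sum>r\<in>{0..M}. x powi r\<^sup>2 * qbin (2 * L + M - r) (2 * L) * bos N K i (L - r) r) =
    bos N (K + 2) (i + 1) L M"
proof -
  let ?g = "\<lambda>r. x powi r\<^sup>2 * qbin (2 * L + M - r) (2 * L)"
  have 1: "(\<Sum>r\<in>{0..M}. ?g r * bprod (L - r) r (K * t) (2 * t)) = x powi (2 * t)\<^sup>2 *
    bprod L M ((K + 2) * t) (2 * t)" for t
    using burge[of "K * t" "2 * t" L M] assms by (simp add: algebra_simps)
  have 2: "(\<Sum>r\<in>{0..M}. ?g r * bprod (L - r) r (K * t - i) (2 * t - 1)) =
      x powi (2 * t - 1)\<^sup>2 * bprod L M ((K + 2) * t - (i + 1)) (2 * t - 1)" for t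
    using burge[OF mult_affine_nonneg[OF assms, of t], of L M] by (simp add: algebra_simps)
  have "(\<Sum>r\<in>{0..M}. ?g r * bos N K i (L - r) r) =
    (\<Sum>t\<in>{-N..N}. x powi (t * (2 * K * t + K - 2 * i)) *
      (\<Sum>r\<in>{0..M}. ?g r * bprod (L - r) r (K * t) (2 * t)) -
     x powi ((2 * t - 1) * (K * t - i)) * (\<Sum>r\<in>{0..M}. ?g r *
       bprod (L - r) r (K * t - i) (2 * t - 1)))"
    unfolding bos_def sum_distrib_left
    by (subst sum.swap) (simp add: sum_subtractf algebra_simps)
  also have "\<dots> = bos N (K + 2) (i + 1) L M"
    unfolding bos_def 1 2
  proof (intro sum.cong refl)
    fix t
    have e: "x powi (t * (2 * K * t + K - 2 * i)) * x powi (2 * t)\<^sup>2 =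
      x powi (t * (2 * (K + 2) * t + (K + 2) - 2 * (i + 1)))"
      "x powi ((2 * t - 1) * (K * t - i)) * x powi (2 * t - 1)\<^sup>2 =
        x powi ((2 * t - 1) * ((K + 2) * t - (i + 1)))"
      unfolding powi_add by (rule arg_cong[where f =
        "power_int x"]; simp add: power2_eq_square algebra_simps)+
    show "x powi (t * (2 * K * t + K - 2 * i)) *
      (x powi (2 * t)\<^sup>2 * bprod L M ((K + 2) * t) (2 * t)) -
         x powi ((2 * t - 1) * (K * t - i)) *
           (x powi (2 * t - 1)\<^sup>2 * bprod L M ((K + 2) * t - (i + 1)) (2 * t - 1)) =
         x powi (t * (2 * (K + 2) * t + (K + 2) - 2 * (i + 1))) * bprod L M ((K + 2) * t) (2 * t) -
         x powi ((2 * t - 1) * ((K + 2) * t - (i + 1))) *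
           bprod L M ((K + 2) * t - (i + 1)) (2 * t - 1)"
      unfolding mult.assoc[symmetric] e ..
  qed
  finally show ?thesis .
qed

lemma bos_burge_limit:
  assumes "0 \<le> i" "i \<le> K"
  shows "(\<Sum>r\<in>{0..L}. x powi r\<^sup>2 * bos N K i (L - r) r) = bos_limit N (K + 2) (i + 1) L"
proof -
  have 1: "(\<Sum>r\<in>{0..L}. x powi r\<^sup>2 * bprod (L - r) r (K * t) (2 * t)) = x powi (2 * t)\<^sup>2 *
    qbin (2 * L) (L - (K + 2) * t)" for t
    using burge_limit[of "K * t" "2 * t" L] assms by (simp add: algebra_simps)
  have 2: "(\<Sum>r\<in>{0..L}. x powi r\<^sup>2 * bprod (L - r) r (K * t - i) (2 * t - 1)) =
      x powi (2 * t - 1)\<^sup>2 * qbin (2 * L) (L - ((K + 2) * t - (i + 1)))" for t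
    using burge_limit[OF mult_affine_nonneg[OF assms, of t], of L] by (simp add: algebra_simps)
  have "(\<Sum>r\<in>{0..L}. x powi r\<^sup>2 * bos N K i (L - r) r) =
    (\<Sum>t\<in>{-N..N}. x powi (t * (2 * K * t + K - 2 * i)) *
      (\<Sum>r\<in>{0..L}. x powi r\<^sup>2 * bprod (L - r) r (K * t) (2 * t)) -
     x powi ((2 * t - 1) * (K * t - i)) * (\<Sum>r\<in>{0..L}. x powi r\<^sup>2 *
       bprod (L - r) r (K * t - i) (2 * t - 1)))"
    unfolding bos_def sum_distrib_left
    by (subst sum.swap) (simp add: sum_subtractf algebra_simps)
  also have "\<dots> = bos_limit N (K + 2) (i + 1) L"
    unfolding bos_limit_def 1 2
  proof (intro sum.cong refl)
    fix t
    have e: "x powi (t * (2 * K * t + K - 2 * i)) * x powi (2 * t)\<^sup>2 =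
      x powi (t * (2 * (K + 2) * t + (K + 2) - 2 * (i + 1)))"
      "x powi ((2 * t - 1) * (K * t - i)) * x powi (2 * t - 1)\<^sup>2 =
        x powi ((2 * t - 1) * ((K + 2) * t - (i + 1)))"
      unfolding powi_add by (rule arg_cong[where f =
        "power_int x"]; simp add: power2_eq_square algebra_simps)+
    show "x powi (t * (2 * K * t + K - 2 * i)) *
      (x powi (2 * t)\<^sup>2 * qbin (2 * L) (L - (K + 2) * t)) -
         x powi ((2 * t - 1) * (K * t - i)) *
           (x powi (2 * t - 1)\<^sup>2 * qbin (2 * L) (L - ((K + 2) * t - (i + 1)))) =
         x powi (t * (2 * (K + 2) * t + (K + 2) - 2 * (i + 1))) * qbin (2 * L) (L - (K + 2) * t) -
         x powi ((2 * t - 1) * ((K + 2) * t - (i + 1))) *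
           qbin (2 * L) (L - ((K + 2) * t - (i + 1)))"
      unfolding mult.assoc[symmetric] e ..
  qed
  finally show ?thesis .
qed

text \<open>One Burge step from the seed, read with the roles of \<open>L\<close> and \<open>M\<close> interchanged.\<close>

lemma bos_1_0:
  assumes "L \<ge> 0" "M \<ge> 0" "N > M"
  shows "bos N 1 0 L M = (if M = 0 then 1 else 0)"
proof -
  let ?g = "\<lambda>r. x powi r\<^sup>2 * qbin (2 * M + L - r) (2 * M)"
  let ?X = "\<lambda>r. (\<Sum>t\<in>{-N..N}. x powi (t\<^sup>2 + t) * bprod (M - r) r t t - x powi (t\<^sup>2 - t) *
    bprod (M - r) r (t - 1) t)"
  \<comment> \<open>\<open>burge\<close> yields \<open>bprod M L (2 * t) t\<close>; the swap moves
    the doubled index to the last place, as \<open>bos\<close> requires.\<close>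
  have 1: "(\<Sum>r\<in>{0..L}. ?g r * bprod (M - r) r t t) = x powi t\<^sup>2 * bprod L M t (2 * t)" for t
    using burge[of t t M L] by (simp add: bprod_swap[of L] algebra_simps)
  have 2: "(\<Sum>r\<in>{0..L}. ?g r * bprod (M - r) r (t - 1) t) = x powi t\<^sup>2 *
    bprod L M t (2 * t - 1)" for t
  proof -
    have "(t - 1) * t \<ge> 0" by (auto simp: zero_le_mult_iff)
    from burge[OF this, of M L] show ?thesis by (simp add: bprod_swap[of L])
  qed
  have "(\<Sum>r\<in>{0..L}. ?g r * ?X r) =
    (\<Sum>t\<in>{-N..N}. x powi (t\<^sup>2 + t) * (\<Sum>r\<in>{0..L}. ?g r * bprod (M - r) r t t) -
     x powi (t\<^sup>2 - t) * (\<Sum>r\<in>{0..L}. ?g r * bprod (M - r) r (t - 1) t))"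
    unfolding sum_distrib_left
    by (subst sum.swap) (simp add: sum_subtractf algebra_simps)
  also have "\<dots> = bos N 1 0 L M"
    unfolding bos_def 1 2
  proof (intro sum.cong refl)
    fix t
    have e: "x powi (t\<^sup>2 + t) * x powi t\<^sup>2 = x powi (t * (2 * 1 * t + 1 - 2 * 0))"
      "x powi (t\<^sup>2 - t) * x powi t\<^sup>2 = x powi ((2 * t - 1) * (1 * t - 0))"
      unfolding powi_add by (rule arg_cong[where f =
        "power_int x"]; simp add: power2_eq_square algebra_simps)+
    show "x powi (t\<^sup>2 + t) * (x powi t\<^sup>2 * bprod L M t (2 * t)) -
         x powi (t\<^sup>2 - t) * (x powi t\<^sup>2 * bprod L M t (2 * t - 1)) =
         x powi (t * (2 * 1 * t + 1 - 2 * 0)) * bprod L M (1 * t) (2 * t) -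
         x powi ((2 * t - 1) * (1 * t - 0)) * bprod L M (1 * t - 0) (2 * t - 1)"
      unfolding mult.assoc[symmetric] e by simp
  qed
  finally have "bos N 1 0 L M = (\<Sum>r\<in>{0..L}. ?g r * ?X r)" ..
  also have "\<dots> = (\<Sum>r\<in>{0..L}. if r = 0 then (if M = 0 then 1 else 0) else 0)"
  proof (intro sum.cong refl)
    fix r assume "r \<in> {0..L}"
    \<comment> \<open>The arguments \<open>M - r\<close> and \<open>r\<close> of the seed add up to
      \<open>M\<close>, which is why \<open>N > M\<close> suffices for every
      \<open>r\<close>.\<close>
    have "?X r = (if M - r = 0 \<and> r = 0 then 1 else 0)"
      using assms by (intro burge_seed) auto
    then show "?g r * ?X r = (if r = 0 then (if M = 0 then 1 else 0) else 0)"
      using assms by (simp only:) auto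
  qed
  also have "\<dots> = (if M = 0 then 1 else 0)"
    using assms by (simp add: sum.delta)
  finally show ?thesis .
qed

text \<open>A Burge step applied to \<open>bos_1_0\<close>, where only \<open>r = 0\<close>
  survives. The result is the innermost binomial of the left-hand side, the one containing n_k =
  0.\<close>

lemma bos_3_1:
  assumes "L \<ge> 0" "M \<ge> 0" "N > M"
  shows "bos N 3 1 L M = qbin (2 * L + M) M"
proof -
  have "bos N 3 1 L M = (\<Sum>r\<in>{0..M}. x powi r\<^sup>2 * qbin (2 * L + M - r) (2 * L) *
    bos N 1 0 (L - r) r)"
    using bos_burge[of 0 1 L M N] by simp
  also have "\<dots> = (\<Sum>r\<in>{0..M}. if r = 0 then qbin (2 * L + M) (2 * L) else 0)"
  proof (intro sum.cong refl)
    fix r assume r: "r \<in> {0..M}"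
    show "x powi r\<^sup>2 * qbin (2 * L + M - r) (2 * L) * bos N 1 0 (L - r) r =
      (if r = 0 then qbin (2 * L + M) (2 * L) else 0)"
    proof (cases "r \<le> L")
      case True
      then have "bos N 1 0 (L - r) r = (if r = 0 then 1 else 0)"
        using r assms by (intro bos_1_0) auto
      then show ?thesis by simp
    next
      case False
      then show ?thesis using assms by (auto simp: bos_eq_0)
    qed
  qed
  also have "\<dots> = qbin (2 * L + M) M"
    using assms qbin_sym[of "2 * L + M" M] by (simp add: sum.delta)
  finally show ?thesis .
qed

end

section \<open>The half step\<close>

context q_base
begin

text \<open>Absorbs the weight x^r of a variable n_j with j \<ge> i. Pascal for tops
  \<open>X\<close> and \<open>Y\<close> on the right creates a mixed product that cancels; where
  Pascal fails, the assumptions make the accompanying binomial vanish.\<close>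

lemma qbin_half_step:
  assumes "X = 0 \<Longrightarrow> B < 0" "Y = 0 \<Longrightarrow> B \<ge> 0"
  shows "x powi r * (qbin (X - 1) (r - B) * qbin (Y - 1) (r + B) -
      x powi (2 * B + 1) * (qbin (X - 1) (r - B - 1) * qbin (Y - 1) (r + B + 1))) =
    x powi B * (qbin X (r - B) * qbin (Y - 1) (r + B) - qbin (X - 1) (r - B - 1) *
      qbin Y (r + B + 1))"
proof -
  have 1: "qbin X (r - B) * qbin (Y - 1) (r + B) =
      (qbin (X - 1) (r - B - 1) + x powi (r - B) * qbin (X - 1) (r - B)) * qbin (Y - 1) (r + B)"
  proof (cases "X = 0 \<and> r = B")
    case False
    then show ?thesis using qbin_pascal[of X "r - B"] by auto
  qed (use assms in simp)
  have 2: "qbin (X - 1) (r - B - 1) * qbin Y (r + B + 1) =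
      qbin (X - 1) (r - B - 1) * (qbin (Y - 1) (r + B) + x powi (r + B + 1) *
        qbin (Y - 1) (r + B + 1))"
  proof (cases "Y = 0 \<and> r + B + 1 = 0")
    case False
    then show ?thesis using qbin_pascal[of Y "r + B + 1"] by auto
  next
    case True
    then have "qbin (X - 1) (r - B - 1) = 0" using assms by simp
    then show ?thesis by simp
  qed
  have e: "x powi r = x powi B * x powi (r - B)" "x powi (r + B + 1) = x powi (r - B) *
    x powi (2 * B + 1)"
    unfolding powi_add by (simp_all add: algebra_simps)
  show ?thesis unfolding 1 2 e by (simp add: algebra_simps)
qed

text \<open>Collects the side conditions of \<open>q_Saalschuetz\<close> and
  \<open>qbin_half_step\<close>; all follow because \<open>c * t\<close> has the sign of
  \<open>t\<close> and is at least as large in absolute value.\<close>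

lemma half_step_condition:
  fixes L c t :: int
  assumes "L \<ge> 1" "c \<ge> 1"
  shows "L + c * t \<ge> 0 \<and> L - c * t - 1 \<ge> 0 \<or>
      L + c * t + 2 * (2 * t) < 0 \<or> L - c * t - 1 - 2 * (2 * t) < 0"
    and "L + c * t - 1 \<ge> 0 \<and> L - c * t \<ge> 0 \<or>
      L + c * t - 1 + 2 * (2 * t + 1) < 0 \<or> L - c * t - 2 * (2 * t + 1) < 0"
    and "L + c * t = 0 \<Longrightarrow> 2 * t < 0" and "L - c * t = 0 \<Longrightarrow> 2 * t \<ge> 0"
proof -
  have *: "t \<ge> 0 \<and> c * t \<ge> t \<or> t < 0 \<and> c * t \<le> t"
    using assms mult_right_mono[of 1 c t] mult_right_mono_neg[of 1 c t] by (cases "t \<ge> 0") auto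
  show "L + c * t \<ge> 0 \<and> L - c * t - 1 \<ge> 0 \<or>
      L + c * t + 2 * (2 * t) < 0 \<or> L - c * t - 1 - 2 * (2 * t) < 0"
    using * assms(1) by linarith
  show "L + c * t - 1 \<ge> 0 \<and> L - c * t \<ge> 0 \<or>
      L + c * t - 1 + 2 * (2 * t + 1) < 0 \<or> L - c * t - 2 * (2 * t + 1) < 0"
    using * assms(1) by (smt (verit))
  show "2 * t < 0" if "L + c * t = 0" using * assms(1) that by linarith
  show "2 * t \<ge> 0" if "L - c * t = 0" using * assms(1) that by linarith
qed

text \<open>\<open>q_Saalschuetz\<close> with \<open>B = 2 * t\<close> for the first product and
  \<open>B = 2 * t + 1\<close> for the second; in both the tops add up to
  \<open>2 * L - 1\<close>.\<close>

lemma half_step_Saalschuetz: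
  assumes "L \<ge> 1" "c \<ge> 1"
  shows "(\<Sum>r\<in>{0..M}. x powi r\<^sup>2 * qbin (2 * L - 1 + M - r) (2 * L - 1) *
      (qbin (L + c * t) (r - 2 * t) * qbin (L - c * t - 1) (r + 2 * t) -
       qbin (L + c * t - 1) (r - 2 * t - 1) * qbin (L - c * t) (r + 2 * t + 1))) =
    x powi (2 * t)\<^sup>2 * (qbin (L + M + (c + 2) * t) (M - 2 * t) *
      qbin (L + M - (c + 2) * t - 1) (M + 2 * t) -
       x powi (4 * t + 1) * (qbin (L + M + (c + 2) * t) (M - 2 * t - 1) *
         qbin (L + M - (c + 2) * t - 1) (M + 2 * t + 1)))"
  (is "?lhs = _")
proof -
  have *: "L + c * t + (L - c * t - 1) = 2 * L - 1" "L + c * t - 1 + (L - c * t) = 2 * L - 1"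
    by simp_all
  have 1: "(\<Sum>r\<in>{0..M}. x powi (r\<^sup>2 - (2 * t)\<^sup>2) * qbin (L + c * t) (r - 2 * t) *
    qbin (L - c * t - 1) (r + 2 * t) *
      qbin (2 * L - 1 + M - r) (2 * L - 1)) =
      qbin (L + M + (c + 2) * t) (M - 2 * t) * qbin (L + M - (c + 2) * t - 1) (M + 2 * t)"
    using q_Saalschuetz[OF half_step_condition(1)[OF assms, of t], of M] unfolding *
    by (simp add: algebra_simps)
  have 2: "(\<Sum>r\<in>{0..M}. x powi (r\<^sup>2 - (2 * t + 1)\<^sup>2) * qbin (L + c * t - 1) (r - 2 * t - 1) *
    qbin (L - c * t) (r + 2 * t + 1) *
      qbin (2 * L - 1 + M - r) (2 * L - 1)) =
      qbin (L + M + (c + 2) * t) (M - 2 * t - 1) * qbin (L + M - (c + 2) * t - 1) (M + 2 * t + 1)"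
    using q_Saalschuetz[OF half_step_condition(2)[OF assms, of t], of M] unfolding *
    by (simp add: algebra_simps)
  have "?lhs = x powi (2 * t)\<^sup>2 * (\<Sum>r\<in>{0..M}. x powi (r\<^sup>2 - (2 * t)\<^sup>2) *
    qbin (L + c * t) (r - 2 * t) * qbin (L - c * t - 1) (r + 2 * t) *
      qbin (2 * L - 1 + M - r) (2 * L - 1)) - x powi (2 * t + 1)\<^sup>2 *
     (\<Sum>r\<in>{0..M}. x powi (r\<^sup>2 - (2 * t + 1)\<^sup>2) * qbin (L + c * t - 1) (r - 2 * t - 1) *
       qbin (L - c * t) (r + 2 * t + 1) *
      qbin (2 * L - 1 + M - r) (2 * L - 1))"
    unfolding sum_distrib_left sum_subtractf[symmetric]
  proof (intro sum.cong refl)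
    fix r
    have e: "x powi r\<^sup>2 = x powi (2 * t)\<^sup>2 * x powi (r\<^sup>2 - (2 * t)\<^sup>2)"
      "x powi (2 * t + 1)\<^sup>2 * x powi (r\<^sup>2 - (2 * t + 1)\<^sup>2) = x powi (2 * t)\<^sup>2 *
        x powi (r\<^sup>2 - (2 * t)\<^sup>2)"
      unfolding powi_add by (rule arg_cong[where f = "power_int x"]; simp)+
    show "x powi r\<^sup>2 * qbin (2 * L - 1 + M - r) (2 * L - 1) *
         (qbin (L + c * t) (r - 2 * t) * qbin (L - c * t - 1) (r + 2 * t) -
          qbin (L + c * t - 1) (r - 2 * t - 1) * qbin (L - c * t) (r + 2 * t + 1)) =
         x powi (2 * t)\<^sup>2 * (x powi (r\<^sup>2 - (2 * t)\<^sup>2) * qbin (L + c * t) (r - 2 * t) *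
          qbin (L - c * t - 1) (r + 2 * t) * qbin (2 * L - 1 + M - r) (2 * L - 1)) -
         x powi (2 * t + 1)\<^sup>2 * (x powi (r\<^sup>2 - (2 * t + 1)\<^sup>2) *
           qbin (L + c * t - 1) (r - 2 * t - 1) *
          qbin (L - c * t) (r + 2 * t + 1) * qbin (2 * L - 1 + M - r) (2 * L - 1))"
      unfolding mult.assoc[symmetric] e by (simp add: algebra_simps)
  qed
  moreover have "x powi (2 * t + 1)\<^sup>2 = x powi (2 * t)\<^sup>2 * x powi (4 * t + 1)"
    unfolding powi_add by (rule arg_cong[where f =
      "power_int x"]) (simp add: power2_eq_square algebra_simps)
  ultimately show ?thesis unfolding 1 2 by (simp add: algebra_simps)
qed

lemma half_step_Vandermonde:
  assumes "L \<ge> 1" "c \<ge> 1"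
  shows "(\<Sum>r\<in>{0..L - 1}. x powi r\<^sup>2 *
      (qbin (L + c * t) (r - 2 * t) * qbin (L - c * t - 1) (r + 2 * t) -
       qbin (L + c * t - 1) (r - 2 * t - 1) * qbin (L - c * t) (r + 2 * t + 1))) =
    x powi (2 * t)\<^sup>2 * (qbin (2 * L - 1) (L - (c + 4) * t - 1) -
       x powi (4 * t + 1) * qbin (2 * L - 1) (L - (c + 4) * t - 2))"
  (is "?lhs = _")
proof -
  have *: "L + c * t + (L - c * t - 1) = 2 * L - 1" "L + c * t - 1 + (L - c * t) = 2 * L - 1"
    by simp_all
  have 1: "(\<Sum>r\<in>{0..L - 1}. x powi (r\<^sup>2 - (2 * t)\<^sup>2) * qbin (L + c * t) (r - 2 * t) *
    qbin (L - c * t - 1) (r + 2 * t)) =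
      qbin (2 * L - 1) (L - (c + 4) * t - 1)"
    using q_Vandermonde_centred[OF half_step_condition(1)[OF assms, of t], of "L - 1"] unfolding *
    by (simp add: algebra_simps)
  have 2: "(\<Sum>r\<in>{0..L - 1}. x powi (r\<^sup>2 - (2 * t + 1)\<^sup>2) * qbin (L + c * t - 1) (r - 2 * t - 1) *
    qbin (L - c * t) (r + 2 * t + 1)) =
      qbin (2 * L - 1) (L - (c + 4) * t - 2)"
    using q_Vandermonde_centred[OF half_step_condition(2)[OF assms, of t], of "L - 1"] unfolding *
    by (simp add: algebra_simps)
  have "?lhs = x powi (2 * t)\<^sup>2 * (\<Sum>r\<in>{0..L - 1}. x powi (r\<^sup>2 - (2 * t)\<^sup>2) *
    qbin (L + c * t) (r - 2 * t) * qbin (L - c * t - 1) (r + 2 * t))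
     - x powi (2 * t + 1)\<^sup>2 *
     (\<Sum>r\<in>{0..L - 1}. x powi (r\<^sup>2 - (2 * t + 1)\<^sup>2) * qbin (L + c * t - 1) (r - 2 * t - 1) *
       qbin (L - c * t) (r + 2 * t + 1))"
    unfolding sum_distrib_left sum_subtractf[symmetric]
  proof (intro sum.cong refl)
    fix r
    have e: "x powi r\<^sup>2 = x powi (2 * t)\<^sup>2 * x powi (r\<^sup>2 - (2 * t)\<^sup>2)"
      "x powi (2 * t + 1)\<^sup>2 * x powi (r\<^sup>2 - (2 * t + 1)\<^sup>2) = x powi (2 * t)\<^sup>2 *
        x powi (r\<^sup>2 - (2 * t)\<^sup>2)"
      unfolding powi_add by (rule arg_cong[where f = "power_int x"]; simp)+
    show "x powi r\<^sup>2 *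
         (qbin (L + c * t) (r - 2 * t) * qbin (L - c * t - 1) (r + 2 * t) -
          qbin (L + c * t - 1) (r - 2 * t - 1) * qbin (L - c * t) (r + 2 * t + 1)) =
         x powi (2 * t)\<^sup>2 * (x powi (r\<^sup>2 - (2 * t)\<^sup>2) * qbin (L + c * t) (r - 2 * t) *
          qbin (L - c * t - 1) (r + 2 * t)) -
         x powi (2 * t + 1)\<^sup>2 * (x powi (r\<^sup>2 - (2 * t + 1)\<^sup>2) *
           qbin (L + c * t - 1) (r - 2 * t - 1) *
          qbin (L - c * t) (r + 2 * t + 1))"
      unfolding mult.assoc[symmetric] e by (simp add: algebra_simps)
  qed
  moreover have "x powi (2 * t + 1)\<^sup>2 = x powi (2 * t)\<^sup>2 * x powi (4 * t + 1)"
    unfolding powi_add by (rule arg_cong[where f =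
      "power_int x"]) (simp add: power2_eq_square algebra_simps)
  ultimately show ?thesis unfolding 1 2 by (simp add: algebra_simps)
qed

text \<open>For \<open>i = 1\<close>, replacing t by -t in the odd terms turns their index pair into
  the negative of (Kt + 1, 2t + 1), and \<open>bprod\<close> is even in that pair. Each odd term
  thus joins a neighbouring even term with a common power of \<open>x\<close>.\<close>

lemma bos_1_reflect:
  "bos N K 1 L M = (\<Sum>t\<in>{-N..N}. x powi (2 * K * t\<^sup>2 + (K - 2) * t) *
     (bprod L M (K * t) (2 * t) - x powi (4 * t + 1) * bprod L M (K * t + 1) (2 * t + 1)))"
proof -
  have "x powi ((2 * (- t) - 1) * (K * (- t) - 1)) * bprod L M (K * (- t) - 1) (2 * (- t) - 1) =
      x powi (2 * K * t\<^sup>2 + (K - 2) * t) * x powi (4 * t + 1) *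
        bprod L M (K * t + 1) (2 * t + 1)" for t
  proof -
    have "bprod L M (K * (- t) - 1) (2 * (- t) - 1) = bprod L M (K * t + 1) (2 * t + 1)"
      by (simp add: bprod_def algebra_simps)
    moreover have "(2 * (- t) - 1) * (K * (- t) - 1) = 2 * K * t\<^sup>2 + (K - 2) * t + (4 * t + 1)"
      by (simp add: algebra_simps power2_eq_square)
    ultimately show ?thesis unfolding powi_add by simp
  qed
  then show ?thesis
    unfolding bos_def sum_subtractf right_diff_distrib
    by (subst (2) sum_int_reflect) (simp add: algebra_simps power2_eq_square)
qed

lemma bos_limit_1_reflect:
  "bos_limit N K 1 L = (\<Sum>t\<in>{-N..N}. x powi (2 * K * t\<^sup>2 + (K - 2) * t) *
     (qbin (2 * L) (L - K * t) - x powi (4 * t + 1) * qbin (2 * L) (L - K * t - 1)))"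
proof -
  have "x powi ((2 * (- t) - 1) * (K * (- t) - 1)) * qbin (2 * L) (L - (K * (- t) - 1)) =
      x powi (2 * K * t\<^sup>2 + (K - 2) * t) * x powi (4 * t + 1) * qbin (2 * L) (L - K * t - 1)" for t
    using qbin_sym[of "2 * L" "L - K * t - 1"] unfolding powi_add
    by (simp add: algebra_simps power2_eq_square)
  then show ?thesis
    unfolding bos_limit_def sum_subtractf right_diff_distrib
    by (subst (2) sum_int_reflect) (simp add: algebra_simps power2_eq_square)
qed

text \<open>The form of \<open>x powi r * bos N K 1 (L - 1 - r) r\<close> after
  \<open>qbin_half_step\<close> has absorbed the power, see \<open>bos_half\<close>.\<close>

definition half_step_kernel :: "int \<Rightarrow> int \<Rightarrow> int \<Rightarrow> int \<Rightarrow> 'a" where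
  "half_step_kernel N K L r = (\<Sum>t\<in>{-N..N}. x powi (2 * K * t\<^sup>2 + K * t) *
      (qbin (L + (K - 2) * t) (r - 2 * t) * qbin (L - (K - 2) * t - 1) (r + 2 * t) -
       qbin (L + (K - 2) * t - 1) (r - 2 * t - 1) * qbin (L - (K - 2) * t) (r + 2 * t + 1)))"

lemma bos_half:
  assumes "L \<ge> 1" "K \<ge> 3"
  shows "x powi r * bos N K 1 (L - 1 - r) r = half_step_kernel N K L r"
  unfolding bos_1_reflect half_step_kernel_def sum_distrib_left
proof (intro sum.cong refl)
  fix t
  define X where "X = L + (K - 2) * t"
  define Y where "Y = L - (K - 2) * t"
  have X0: "X = 0 \<Longrightarrow> 2 * t < 0" "Y = 0 \<Longrightarrow> 2 * t \<ge> 0"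
    using half_step_condition(3,4)[of L "K - 2" t] assms by (simp_all add: X_def Y_def)
  have b: "bprod (L - 1 - r) r (K * t) (2 * t) = qbin (X - 1) (r - 2 * t) *
    qbin (Y - 1) (r + 2 * t)"
    "bprod (L - 1 - r) r (K * t + 1) (2 * t + 1) = qbin (X - 1) (r - 2 * t - 1) *
      qbin (Y - 1) (r + 2 * t + 1)"
    by (simp_all add: bprod_def X_def Y_def algebra_simps)
  have e: "x powi (2 * K * t\<^sup>2 + K * t) = x powi (2 * K * t\<^sup>2 + (K - 2) * t) * x powi (2 * t)"
    unfolding powi_add by (rule arg_cong[where f = "power_int x"]) (simp add: algebra_simps)
  have "x powi r * (qbin (X - 1) (r - 2 * t) * qbin (Y - 1) (r + 2 * t) -
      x powi (4 * t + 1) * (qbin (X - 1) (r - 2 * t - 1) * qbin (Y - 1) (r + 2 * t + 1))) =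
      x powi (2 * t) * (qbin X (r - 2 * t) * qbin (Y - 1) (r + 2 * t) -
        qbin (X - 1) (r - 2 * t - 1) * qbin Y (r + 2 * t + 1))"
    using qbin_half_step[of X "2 * t" Y r] X0 by simp
  then show "x powi r * (x powi (2 * K * t\<^sup>2 + (K - 2) * t) *
      (bprod (L - 1 - r) r (K * t) (2 * t) - x powi (4 * t + 1) *
        bprod (L - 1 - r) r (K * t + 1) (2 * t + 1))) =
      x powi (2 * K * t\<^sup>2 + K * t) * (qbin (L + (K - 2) * t) (r - 2 * t) *
        qbin (L - (K - 2) * t - 1) (r + 2 * t) -
       qbin (L + (K - 2) * t - 1) (r - 2 * t - 1) * qbin (L - (K - 2) * t) (r + 2 * t + 1))"
    unfolding b e X_def[symmetric] Y_def[symmetric]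
    by (simp only: mult.left_commute[of "x powi r"] mult.assoc)
qed

text \<open>\<open>half_step_Vandermonde\<close> produces binomials with top
  \<open>2 * L - 1\<close>. Pascal completes them to top \<open>2 * L\<close>, and the correction
  terms cancel between t and -t.\<close>

lemma bos_half_step_limit:
  assumes "L \<ge> 1" "K \<ge> 3"
  shows "(\<Sum>r\<in>{0..L - 1}. x powi (r\<^sup>2 + r) * bos N K 1 (L - 1 - r) r) = bos_limit N (K + 2) 1 L"
proof -
  define w where "w = (\<lambda>t. x powi (2 * (K + 2) * t\<^sup>2 + K * t))"
  define Q where "Q = (\<lambda>t. qbin (2 * L - 1) (L - (K + 2) * t))"
  define Q' where "Q' = (\<lambda>t. qbin (2 * L - 1) (L - (K + 2) * t - 1))"
  have "(\<Sum>r\<in>{0..L - 1}. x powi (r\<^sup>2 + r) * bos N K 1 (L - 1 - r) r) =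
      (\<Sum>r\<in>{0..L - 1}. x powi r\<^sup>2 * half_step_kernel N K L r)"
    using bos_half[OF assms, of _ N] by (simp add: powi_add[symmetric] mult.assoc)
  also have "\<dots> = (\<Sum>t\<in>{-N..N}. x powi (2 * K * t\<^sup>2 + K * t) * (\<Sum>r\<in>{0..L - 1}. x powi r\<^sup>2 *
      (qbin (L + (K - 2) * t) (r - 2 * t) * qbin (L - (K - 2) * t - 1) (r + 2 * t) -
       qbin (L + (K - 2) * t - 1) (r - 2 * t - 1) * qbin (L - (K - 2) * t) (r + 2 * t + 1))))"
    unfolding half_step_kernel_def sum_distrib_left by (subst sum.swap) (simp add: mult_ac)
  also have "\<dots> = (\<Sum>t\<in>{-N..N}. w t * (Q' t - x powi (4 * t + 1) *
    qbin (2 * L - 1) (L - (K + 2) * t - 2)))"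
  proof (intro sum.cong refl)
    fix t
    have e: "x powi (2 * K * t\<^sup>2 + K * t) * x powi (2 * t)\<^sup>2 = w t"
      unfolding powi_add w_def by (rule arg_cong[where f =
        "power_int x"]) (simp add: power2_eq_square algebra_simps)
    have s: "K - 2 + 4 = K + 2" by simp
    show "x powi (2 * K * t\<^sup>2 + K * t) * (\<Sum>r\<in>{0..L - 1}. x powi r\<^sup>2 *
      (qbin (L + (K - 2) * t) (r - 2 * t) * qbin (L - (K - 2) * t - 1) (r + 2 * t) -
       qbin (L + (K - 2) * t - 1) (r - 2 * t - 1) * qbin (L - (K - 2) * t) (r + 2 * t + 1))) =
      w t * (Q' t - x powi (4 * t + 1) * qbin (2 * L - 1) (L - (K + 2) * t - 2))"
      using half_step_Vandermonde[of L "K - 2" t] assms unfolding e[symmetric] s Q'_def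
        by (simp add: mult.assoc)
  qed
  also have "\<dots> = bos_limit N (K + 2) 1 L - (\<Sum>t\<in>{-N..N}. w t * (x powi (L - (K + 2) * t) * Q t -
      x powi (4 * t + 1) * x powi (L - (K + 2) * t - 1) * Q' t))"
  proof -
    have "qbin (2 * L) (L - (K + 2) * t) = Q' t + x powi (L - (K + 2) * t) * Q t"
      "qbin (2 * L) (L - (K + 2) * t - 1) = qbin (2 * L - 1) (L - (K + 2) * t - 2) +
        x powi (L - (K + 2) * t - 1) * Q' t" for t
      using qbin_pascal[of "2 * L" "L - (K + 2) * t"] qbin_pascal[of "2 * L" "L - (K + 2) * t -
        1"] assms
      by (simp_all add: Q_def Q'_def)
    then show ?thesis
      unfolding bos_limit_1_reflect sum_subtractf[symmetric]
      by (intro sum.cong refl) (simp add: w_def algebra_simps)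
  qed
  also have "(\<Sum>t\<in>{-N..N}. w t * (x powi (L - (K + 2) * t) * Q t -
      x powi (4 * t + 1) * x powi (L - (K + 2) * t - 1) * Q' t)) =
      (\<Sum>t\<in>{-N..N}. x powi (2 * (K + 2) * t\<^sup>2 + L - 2 * t) * Q t) -
      (\<Sum>t\<in>{-N..N}. x powi (2 * (K + 2) * t\<^sup>2 + L + 2 * t) * Q' t)"
  proof -
    have e: "w t * x powi (L - (K + 2) * t) = x powi (2 * (K + 2) * t\<^sup>2 + L - 2 * t)"
      "w t * (x powi (4 * t + 1) * x powi (L - (K + 2) * t - 1)) =
        x powi (2 * (K + 2) * t\<^sup>2 + L + 2 * t)" for t
      unfolding powi_add w_def by (rule arg_cong[where f =
        "power_int x"]; simp add: power2_eq_square algebra_simps)+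
    show ?thesis
      unfolding sum_subtractf[symmetric] e[symmetric] by (simp add: algebra_simps)
  qed
  also have "\<dots> = 0"
  proof -
    \<comment> \<open>Complementary bottoms under the odd top \<open>2 * L - 1\<close>; this
      symmetry exchanges the two correction sums.\<close>
    have "Q' (- t) = Q t" for t
      using qbin_sym[of "2 * L - 1" "L - (K + 2) * t"] by (simp add: Q_def Q'_def algebra_simps)
    then show ?thesis by (subst (2) sum_int_reflect) simp
  qed
  finally show ?thesis by simp
qed

text \<open>Pascal on all four binomials of top \<open>L + M + e\<close> or
  \<open>L + M - e\<close>; the sign of \<open>t\<close> together with L \<ge> 1 keeps them off the
  excluded point. The final bracket is the residue that disappears only after summation over t and
  -t.\<close>

lemma bos_half_step_difference:
  assumes "L \<ge> 1" "M \<ge> 0" "c \<ge> 1" and e_def: "e = c * t"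
  shows "bprod L M ((c + 2) * t) (2 * t) - x powi (4 * t + 1) *
    bprod L M ((c + 2) * t + 1) (2 * t + 1) -
     x powi (2 * L) * (bprod L (M - 1) ((c + 2) * t) (2 * t) - x powi (4 * t + 1) *
       bprod L (M - 1) ((c + 2) * t + 1) (2 * t + 1)) =
     qbin (L + M + e) (M - 2 * t) * qbin (L + M - e - 1) (M + 2 * t) -
     x powi (4 * t + 1) * (qbin (L + M + e) (M - 2 * t - 1) *
       qbin (L + M - e - 1) (M + 2 * t + 1)) +
     (x powi (L - e - 2 * t) * (qbin (L + M - e - 1) (M + 2 * t - 1) *
       qbin (L + M + e - 1) (M - 2 * t)) -
      x powi (L - e + 2 * t) * (qbin (L + M - e - 1) (M + 2 * t) *
        qbin (L + M + e - 1) (M - 2 * t - 1)))"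
proof -
  have s: "t = 0 \<and> e = 0 \<or> t > 0 \<and> e \<ge> t \<or> t < 0 \<and> e \<le> t"
    using assms(3) mult_right_mono[of 1 c t] mult_right_mono_neg[of 1 c t] unfolding e_def
    by (cases "t \<ge> 0") auto
  define X where "X = L + M + e"
  define Y where "Y = L + M - e"
  have b: "bprod L M ((c + 2) * t) (2 * t) = qbin X (M - 2 * t) * qbin Y (M + 2 * t)"
    "bprod L M ((c + 2) * t + 1) (2 * t + 1) = qbin X (M - 2 * t - 1) * qbin Y (M + 2 * t + 1)"
    "bprod L (M - 1) ((c + 2) * t) (2 * t) = qbin (X - 1) (M - 2 * t - 1) *
      qbin (Y - 1) (M + 2 * t - 1)"
    "bprod L (M - 1) ((c + 2) * t + 1) (2 * t + 1) = qbin (X - 1) (M - 2 * t - 2) *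
      qbin (Y - 1) (M + 2 * t)"
    by (simp_all add: bprod_def X_def Y_def e_def algebra_simps)
  have y1: "qbin Y (M + 2 * t) = qbin (Y - 1) (M + 2 * t) + x powi (L - e - 2 * t) *
    qbin (Y - 1) (M + 2 * t - 1)"
  proof -
    have "\<not> (Y = 0 \<and> M + 2 * t = 0)" using s assms(1,2) unfolding Y_def by linarith
    from qbin_pascal'[OF this] show ?thesis by (simp add: Y_def algebra_simps)
  qed
  have y2: "qbin Y (M + 2 * t + 1) = qbin (Y - 1) (M + 2 * t + 1) + x powi (L - e - 2 * t - 1) *
    qbin (Y - 1) (M + 2 * t)"
  proof -
    have "\<not> (Y = 0 \<and> M + 2 * t + 1 = 0)" using s assms(1,2) unfolding Y_def by linarith
    from qbin_pascal'[OF this] show ?thesis by (simp add: Y_def algebra_simps)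
  qed
  have x1: "qbin X (M - 2 * t) = qbin (X - 1) (M - 2 * t) + x powi (L + e + 2 * t) *
    qbin (X - 1) (M - 2 * t - 1)"
  proof -
    have "\<not> (X = 0 \<and> M - 2 * t = 0)" using s assms(1,2) unfolding X_def by linarith
    from qbin_pascal'[OF this] show ?thesis by (simp add: X_def algebra_simps)
  qed
  have x2: "qbin X (M - 2 * t - 1) = qbin (X - 1) (M - 2 * t - 1) + x powi (L + e + 2 * t + 1) *
    qbin (X - 1) (M - 2 * t - 2)"
  proof -
    have "\<not> (X = 0 \<and> M - 2 * t - 1 = 0)" using s assms(1,2) unfolding X_def by linarith
    from qbin_pascal'[OF this] show ?thesis by (simp add: X_def algebra_simps)
  qed
  have p: "x powi (2 * L) = x powi (L - e - 2 * t) * x powi (L + e + 2 * t)"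
    "x powi (L + e + 2 * t + 1) = x powi (L + e + 2 * t) * x"
    "x powi (4 * t + 1) = x powi (4 * t) * x"
    "x powi (L - e + 2 * t) = x powi (L - e - 2 * t) * x powi (4 * t)"
    "x powi (L - e - 2 * t) = x powi (L - e - 2 * t - 1) * x"
    using powi_add[of _ 1] by (simp_all add: powi_add algebra_simps)
  have fold: "L + M + e = X" "L + M - e = Y" by (simp_all add: X_def Y_def)
  show ?thesis
    unfolding b fold y1 y2
    unfolding x1 x2 p(1,2,3,4) unfolding p(5)
    by (simp add: algebra_simps)
qed

text \<open>The first-order recurrence in \<open>M\<close> behind \<open>bos_half_step\<close>. The
  two residual sums, over \<open>P t\<close> and \<open>P (- t)\<close>, are exchanged by t
  \<mapsto> -t and cancel; at \<open>K + 2\<close> the remaining right side is what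
  \<open>half_step_Saalschuetz\<close> delivers.\<close>

lemma bos_1_recurrence:
  assumes "L \<ge> 1" "M \<ge> 0" "K \<ge> 3"
  shows "bos N K 1 L M - x powi (2 * L) * bos N K 1 L (M - 1) =
    (\<Sum>t\<in>{-N..N}. x powi (2 * K * t\<^sup>2 + (K - 2) * t) *
      (qbin (L + M + (K - 2) * t) (M - 2 * t) * qbin (L + M - (K - 2) * t - 1) (M + 2 * t) -
       x powi (4 * t + 1) * (qbin (L + M + (K - 2) * t) (M - 2 * t - 1) *
         qbin (L + M - (K - 2) * t - 1) (M + 2 * t + 1))))"
  (is "_ = ?rhs")
proof -
  define P where "P = (\<lambda>t. qbin (L + M - (K - 2) * t - 1) (M + 2 * t - 1) *
    qbin (L + M + (K - 2) * t - 1) (M - 2 * t))"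
  have "bos N K 1 L M - x powi (2 * L) * bos N K 1 L (M - 1) = ?rhs +
    ((\<Sum>t\<in>{-N..N}. x powi (2 * K * t\<^sup>2 + L - 2 * t) * P t) -
     (\<Sum>t\<in>{-N..N}. x powi (2 * K * t\<^sup>2 + L + 2 * t) * P (- t)))"
    unfolding bos_1_reflect sum_distrib_left sum_subtractf[symmetric] sum.distrib[symmetric]
  proof (intro sum.cong refl)
    fix t
    define w where "w = x powi (2 * K * t\<^sup>2 + (K - 2) * t)"
    have e: "x powi (2 * K * t\<^sup>2 + L - 2 * t) = w * x powi (L - (K - 2) * t - 2 * t)"
       "x powi (2 * K * t\<^sup>2 + L + 2 * t) = w * x powi (L - (K - 2) * t + 2 * t)"
      unfolding w_def powi_add by (simp_all add: algebra_simps)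
    have Pm: "P (- t) = qbin (L + M - (K - 2) * t - 1) (M + 2 * t) *
      qbin (L + M + (K - 2) * t - 1) (M - 2 * t - 1)"
      by (simp add: P_def mult.commute)
    have K: "K - 2 + 2 = K" by simp
    have regroup: "w * A - u * (w * B) = w * (A - u * B)" for A B u :: 'a
      by (simp add: algebra_simps)
    show "x powi (2 * K * t\<^sup>2 + (K - 2) * t) *
         (bprod L M (K * t) (2 * t) - x powi (4 * t + 1) * bprod L M (K * t + 1) (2 * t + 1)) -
         x powi (2 * L) * (x powi (2 * K * t\<^sup>2 + (K - 2) * t) *
          (bprod L (M - 1) (K * t) (2 * t) - x powi (4 * t + 1) *
            bprod L (M - 1) (K * t + 1) (2 * t + 1))) =
         x powi (2 * K * t\<^sup>2 + (K - 2) * t) *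
         (qbin (L + M + (K - 2) * t) (M - 2 * t) * qbin (L + M - (K - 2) * t - 1) (M + 2 * t) -
          x powi (4 * t + 1) * (qbin (L + M + (K - 2) * t) (M - 2 * t - 1) *
            qbin (L + M - (K - 2) * t - 1) (M + 2 * t + 1))) +
         (x powi (2 * K * t\<^sup>2 + L - 2 * t) * P t - x powi (2 * K * t\<^sup>2 + L + 2 * t) * P (- t))"
      unfolding e w_def[symmetric] regroup Pm unfolding P_def
      using bos_half_step_difference[of L M "K - 2" "(K - 2) * t" t, unfolded K] assms
      by (simp only:) (simp add: algebra_simps)
  qed
  moreover have "(\<Sum>t\<in>{-N..N}. x powi (2 * K * t\<^sup>2 + L + 2 * t) * P (- t)) =
    (\<Sum>t\<in>{-N..N}. x powi (2 * K * t\<^sup>2 + L - 2 * t) * P t)"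
    by (subst sum_int_reflect) simp
  ultimately show ?thesis by simp
qed

text \<open>
  Both sides satisfy the same first-order recurrence in \<open>M\<close>; unlike for the Burge transform the
  summands for a fixed \<open>t\<close> do not agree, only their sum over \<open>t\<close> and \<open>- t\<close> does.
\<close>

lemma bos_half_step:
  assumes "L \<ge> 1" "K \<ge> 3" "M \<ge> -1"
  shows "(\<Sum>r\<in>{0..M}. x powi (r\<^sup>2 + r) * qbin (2 * L + M - r) (2 * L) * bos N K 1 (L - 1 - r) r) =
    bos N (K + 2) 1 L M"
proof -
  define D where "D = (\<lambda>M. \<Sum>r\<in>{0..M}. x powi r\<^sup>2 * qbin (2 * L + M - r) (2 * L) *
    half_step_kernel N K L r)"
  have "D M = bos N (K + 2) 1 L M"
    using assms(3)
  proof (induction M rule: int_ge_induct)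
    \<comment> \<open>At \<open>M = -1\<close> the left side is an empty sum and the right side has
      a negative argument, so both are 0.\<close>
    case base
    then show ?case by (simp add: D_def bos_eq_0)
  next
    case (step M')
    define M where "M = M' + 1"
    have M: "M \<ge> 0" "M' = M - 1" using step by (simp_all add: M_def)
    \<comment> \<open>The added term \<open>r = M\<close> has top \<open>2 * L - 1\<close> below its
      bottom \<open>2 * L\<close>, so it is 0.\<close>
    have "D (M - 1) = (\<Sum>r\<in>{0..M}. x powi r\<^sup>2 * qbin (2 * L + M - r - 1) (2 * L) *
      half_step_kernel N K L r)"
      unfolding D_def by (rule sum.mono_neutral_cong_left) (auto simp: algebra_simps)
    then have "D M - x powi (2 * L) * D (M - 1) = (\<Sum>r\<in>{0..M}. x powi r\<^sup>2 *
        (qbin (2 * L + M - r) (2 * L) - x powi (2 * L) * qbin (2 * L + M - r - 1) (2 * L)) *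
          half_step_kernel N K L r)"
      by (simp add: D_def sum_distrib_left sum_subtractf[symmetric] algebra_simps)
    also have "\<dots> = (\<Sum>r\<in>{0..M}. x powi r\<^sup>2 * qbin (2 * L - 1 + M - r) (2 * L - 1) *
      half_step_kernel N K L r)"
    proof (intro sum.cong refl)
      fix r
      \<comment> \<open>Pascal lowers the kernel bottom to \<open>2 * L - 1\<close>, the sum of the
        tops in \<open>half_step_kernel\<close>.\<close>
      have "qbin (2 * L + M - r) (2 * L) - x powi (2 * L) * qbin (2 * L + M - r - 1) (2 * L) =
        qbin (2 * L - 1 + M - r) (2 * L - 1)"
        using qbin_pascal[of "2 * L + M - r" "2 * L"] assms by (simp add: algebra_simps)
      then show "x powi r\<^sup>2 * (qbin (2 * L + M - r) (2 * L) - x powi (2 * L) *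
        qbin (2 * L + M - r - 1) (2 * L)) * half_step_kernel N K L r =
        x powi r\<^sup>2 * qbin (2 * L - 1 + M - r) (2 * L - 1) * half_step_kernel N K L r" by simp
    qed
    also have "\<dots> = (\<Sum>t\<in>{-N..N}. x powi (2 * K * t\<^sup>2 + K * t) *
      (\<Sum>r\<in>{0..M}. x powi r\<^sup>2 * qbin (2 * L - 1 + M - r) (2 * L - 1) *
      (qbin (L + (K - 2) * t) (r - 2 * t) * qbin (L - (K - 2) * t - 1) (r + 2 * t) -
       qbin (L + (K - 2) * t - 1) (r - 2 * t - 1) * qbin (L - (K - 2) * t) (r + 2 * t + 1))))"
      unfolding half_step_kernel_def sum_distrib_left by (subst sum.swap) (simp add: mult_ac)
    also have "\<dots> = (\<Sum>t\<in>{-N..N}. x powi (2 * (K + 2) * t\<^sup>2 + (K + 2 - 2) * t) *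
      (qbin (L + M + (K + 2 - 2) * t) (M - 2 * t) * qbin (L + M - (K + 2 - 2) * t - 1) (M + 2 * t) -
       x powi (4 * t + 1) * (qbin (L + M + (K + 2 - 2) * t) (M - 2 * t - 1) *
         qbin (L + M - (K + 2 - 2) * t - 1) (M + 2 * t + 1))))"
    proof (intro sum.cong refl)
      fix t
      have e: "x powi (2 * (K + 2) * t\<^sup>2 + (K + 2 - 2) * t) = x powi (2 * K * t\<^sup>2 + K * t) *
        x powi (2 * t)\<^sup>2"
        unfolding powi_add by (rule arg_cong[where f =
          "power_int x"]) (simp add: power2_eq_square algebra_simps)
      have K: "K - 2 + 2 = K + 2 - 2" by simp
      show "x powi (2 * K * t\<^sup>2 + K * t) * (\<Sum>r\<in>{0..M}. x powi r\<^sup>2 *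
        qbin (2 * L - 1 + M - r) (2 * L - 1) *
        (qbin (L + (K - 2) * t) (r - 2 * t) * qbin (L - (K - 2) * t - 1) (r + 2 * t) -
         qbin (L + (K - 2) * t - 1) (r - 2 * t - 1) * qbin (L - (K - 2) * t) (r + 2 * t + 1))) =
       x powi (2 * (K + 2) * t\<^sup>2 + (K + 2 - 2) * t) *
      (qbin (L + M + (K + 2 - 2) * t) (M - 2 * t) * qbin (L + M - (K + 2 - 2) * t - 1) (M + 2 * t) -
       x powi (4 * t + 1) * (qbin (L + M + (K + 2 - 2) * t) (M - 2 * t - 1) *
         qbin (L + M - (K + 2 - 2) * t - 1) (M + 2 * t + 1)))"
        using half_step_Saalschuetz[of L "K - 2" M t, unfolded K] assms unfolding e
          by (simp only: mult.assoc)
    qed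
    also have "\<dots> = bos N (K + 2) 1 L M - x powi (2 * L) * bos N (K + 2) 1 L (M - 1)"
      using M assms by (intro bos_1_recurrence[symmetric]) auto
    finally have "D M = bos N (K + 2) 1 L M" using step.IH M by simp
    then show ?case by (simp add: M_def)
  qed
  moreover have "(\<Sum>r\<in>{0..M}. x powi (r\<^sup>2 + r) * qbin (2 * L + M - r) (2 * L) *
    bos N K 1 (L - 1 - r) r) = D M"
    unfolding D_def
  proof (intro sum.cong refl)
    fix r
    show "x powi (r\<^sup>2 + r) * qbin (2 * L + M - r) (2 * L) * bos N K 1 (L - 1 - r) r =
      x powi r\<^sup>2 * qbin (2 * L + M - r) (2 * L) * half_step_kernel N K L r"
      unfolding bos_half[OF assms(1,2), symmetric] powi_add[symmetric] by (simp add: mult_ac)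
  qed
  ultimately show ?thesis by simp
qed

text \<open>Supplies the value at \<open>L = 0\<close>, outside the range of
  \<open>bos_half_step\<close>. There \<open>bprod 0 M a b\<close> needs \<open>a = 0\<close>, and
  \<open>K * t - 1\<close> is never 0.\<close>

lemma bos_1_at_0:
  assumes "K \<ge> 2" "M \<ge> 0" "N \<ge> 0"
  shows "bos N K 1 0 M = 1"
proof -
  have K1: "K * t \<noteq> 1" for t using assms by (auto simp: zmult_eq_1_iff)
  have "bos N K 1 0 M = (\<Sum>t\<in>{-N..N}. if t = 0 then 1 else 0)"
    unfolding bos_def
  proof (intro sum.cong refl)
    fix t
    have "bprod 0 M (K * t - 1) (2 * t - 1) = 0"
      using K1[of t] by (auto simp: bprod_def qbin_eq_0_iff)
    moreover have "bprod 0 M (K * t) (2 * t) = (if t = 0 then 1 else 0)"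
      using assms by (auto simp: bprod_def qbin_eq_0_iff linorder_neq_iff mult_less_0_iff
        zero_less_mult_iff)
    ultimately show "x powi (t * (2 * K * t + K - 2 * 1)) * bprod 0 M (K * t) (2 * t) -
         x powi ((2 * t - 1) * (K * t - 1)) * bprod 0 M (K * t - 1) (2 * t - 1) =
           (if t = 0 then 1 else 0)"
      by simp
  qed
  also have "\<dots> = 1" using assms by (simp add: sum.delta)
  finally show ?thesis .
qed

lemma bos_limit_at_0:
  assumes "K \<ge> 2" "N \<ge> 0"
  shows "bos_limit N K 1 0 = 1"
proof -
  have K1: "K * t \<noteq> 1" for t using assms by (auto simp: zmult_eq_1_iff)
  have "bos_limit N K 1 0 = (\<Sum>t\<in>{-N..N}. if t = 0 then 1 else 0)"
    unfolding bos_limit_def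
  proof (intro sum.cong refl)
    fix t
    have "qbin 0 (0 - (K * t - 1)) = 0"
      using K1[of t] by (auto simp: qbin_eq_0_iff)
    moreover have "qbin 0 (0 - K * t) = (if t = 0 then 1 else 0)"
      using assms by (auto simp: qbin_eq_0_iff linorder_neq_iff mult_less_0_iff zero_less_mult_iff)
    ultimately show "x powi (t * (2 * K * t + K - 2 * 1)) * qbin (2 * 0) (0 - K * t) -
         x powi ((2 * t - 1) * (K * t - 1)) * qbin (2 * 0) (0 - (K * t - 1)) =
           (if t = 0 then 1 else 0)"
      by simp
  qed
  also have "\<dots> = 1" using assms by (simp add: sum.delta)
  finally show ?thesis .
qed

end

section \<open>The fermionic sum\<close>

text \<open>Monotonicity is left out so that coordinates can be split off one at a time;
  \<open>infsum_lhs_box\<close> shows that the non-monotone points contribute 0.\<close>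

definition box :: "nat \<Rightarrow> nat \<Rightarrow> (nat \<Rightarrow> nat) set" where
  "box k n = {\<nu>. \<forall>j. (j \<in> {1..<k} \<longrightarrow> \<nu> j \<in> {..n}) \<and> (j \<notin> {1..<k} \<longrightarrow> \<nu> j = 0)}"

lemma finite_box: "finite (box k n)"
  unfolding box_def by (rule finite_set_of_finite_funs) simp_all

lemma box_1: "box (Suc 0) n = {\<lambda>_. 0}"
  by (auto simp: box_def)

lemma sum_box_Suc:
  assumes "j \<ge> 1"
  shows "(\<Sum>\<nu>\<in>box (Suc j) n. F \<nu>) = (\<Sum>\<nu>\<in>box j n. \<Sum>r\<in>{..n}. F (\<nu>(j := r)))"
proof -
  have "(\<Sum>\<nu>\<in>box (Suc j) n. F \<nu>) = (\<Sum>(\<nu>, r)\<in>box j n \<times> {..n}. F (\<nu>(j := r)))"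
    by (rule sum.reindex_bij_witness[where i = "\<lambda>(\<nu>, r). \<nu>(j := r)" and j = "\<lambda>\<nu>. (\<nu>(j := 0), \<nu> j)"])
      (use assms in \<open>auto simp: box_def less_Suc_eq\<close>)
  then show ?thesis by (simp add: sum.cartesian_product)
qed

lemma alpha_Suc: "i \<ge> 1 \<Longrightarrow> alpha i (Suc m) = alpha i m + (if i \<le> Suc m then 1 else 0)"
  by (auto simp: alpha_def)

context q_base
begin

definition qbin' :: "int \<Rightarrow> int \<Rightarrow> 'a" where
  "qbin' a b = (if a < 0 \<and> b = 0 then 1 else qbin a b)"

text \<open>
  The nested sum over \<open>n\<^sub>j, \<dots>, n\<^sub>k\<^sub>-\<^sub>1\<close> with \<open>M = n\<^sub>j\<^sub>-\<^sub>1\<close> and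
  \<open>L = n - n\<^sub>1 - \<dots> - n\<^sub>j\<^sub>-\<^sub>1 - \<alpha>\<^sub>i\<^sub>,\<^sub>j\<^sub>-\<^sub>1\<close>; the list holds the increments
  \<open>\<alpha>\<^sub>i\<^sub>,\<^sub>l - \<alpha>\<^sub>i\<^sub>,\<^sub>l\<^sub>-\<^sub>1\<close>, which are 0 for \<open>l < i\<close> and 1 afterwards.
\<close>

fun tail_sum :: "int list \<Rightarrow> int \<Rightarrow> int \<Rightarrow> 'a" where
  "tail_sum [] L M = qbin' (2 * L + M) M"
| "tail_sum (d # ds) L M =
     (\<Sum>r\<in>{0..M}. x powi (r\<^sup>2 + d * r) * qbin' (2 * L + M - r) (M - r) * tail_sum ds (L - r - d) r)"

lemma qbin'_nonneg: "L \<ge> 0 \<Longrightarrow> r \<le> M \<Longrightarrow> qbin' (2 * L + M - r) (M - r) = qbin (2 * L + M - r) (2 * L)"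
  using qbin_sym[of "2 * L + M - r" "M - r"] by (simp add: qbin'_def)

text \<open>Here the convention for a negative top and bottom 0 enters: it makes the binomial of the
  term \<open>r = M\<close> equal to 1, while for \<open>r < M\<close> the bottom is positive and
  exceeds the top. Only \<open>r = M\<close> is passed down the recursion.\<close>

lemma tail_sum_neg:
  assumes "L < 0" "M \<ge> 0" "\<forall>d\<in>set ds. d \<ge> 0"
  shows "tail_sum ds L M = (if M = 0 then 1 else 0)"
  using assms
proof (induction ds arbitrary: L M)
  case Nil
  then show ?case by (auto simp: qbin'_def qbin_eq_0_iff)
next
  case (Cons d ds)
  have "tail_sum (d # ds) L M = (\<Sum>r\<in>{0..M}. if r = M then (if M = 0 then 1 else 0) else 0)"
    unfolding tail_sum.simps
  proof (intro sum.cong refl)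
    fix r assume r: "r \<in> {0..M}"
    show "x powi (r\<^sup>2 + d * r) * qbin' (2 * L + M - r) (M - r) * tail_sum ds (L - r - d) r =
      (if r = M then (if M = 0 then 1 else 0) else 0)"
    proof (cases "r = M")
      case True
      then show ?thesis using Cons.prems r Cons.IH[of "L - r - d" r] by (simp add: qbin'_def)
    next
      case False
      then show ?thesis using Cons.prems r by (simp add: qbin'_def)
    qed
  qed
  then show ?case using Cons.prems by simp
qed

lemma tail_sum_ones:
  assumes "L \<ge> 0" "M \<ge> 0" "N > M"
  shows "tail_sum (replicate b 1) L M = bos N (2 * int b + 3) 1 L M"
  using assms
proof (induction b arbitrary: L M)
  case 0
  then show ?case by (simp add: bos_3_1 qbin'_def)
next
  case (Suc b)
  show ?case
  \<comment> \<open>The half step requires L \<ge> 1. At \<open>L = 0\<close> every inner tail has a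
    negative first argument, so \<open>tail_sum_neg\<close> leaves only
    \<open>r = 0\<close>.\<close>
  proof (cases "L = 0")
    case True
    have "tail_sum (replicate (Suc b) 1) L M = (\<Sum>r\<in>{0..M}. if r = 0 then 1 else 0)"
      unfolding replicate_Suc tail_sum.simps
    proof (intro sum.cong refl)
      fix r assume r: "r \<in> {0..M}"
      then have "tail_sum (replicate b 1) (L - r - 1) r = (if r = 0 then 1 else 0)"
        using True by (intro tail_sum_neg) auto
      then show "x powi (r\<^sup>2 + 1 * r) * qbin' (2 * L + M - r) (M - r) *
        tail_sum (replicate b 1) (L - r - 1) r = (if r = 0 then 1 else 0)"
        using True Suc.prems by (auto simp: qbin'_def)
    qed
    also have "\<dots> = 1" using Suc.prems by (simp add: sum.delta)
    finally show ?thesis using True Suc.prems bos_1_at_0[of "2 * int (Suc b) + 3" M N] by simp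
  next
    case False
    have "tail_sum (replicate (Suc b) 1) L M =
      (\<Sum>r\<in>{0..M}. x powi (r\<^sup>2 + r) * qbin (2 * L + M - r) (2 * L) *
        bos N (2 * int b + 3) 1 (L - 1 - r) r)"
      unfolding replicate_Suc tail_sum.simps
    proof (intro sum.cong refl)
      fix r assume r: "r \<in> {0..M}"
      have "tail_sum (replicate b 1) (L - r - 1) r = bos N (2 * int b + 3) 1 (L - 1 - r) r"
      proof (cases "r \<le> L - 1")
        case True
        then have "tail_sum (replicate b 1) (L - 1 - r) r = bos N (2 * int b + 3) 1 (L - 1 - r) r"
          using Suc.prems r by (intro Suc.IH) auto
        then show ?thesis by (simp add: algebra_simps)
      next
        \<comment> \<open>Now r > L - 1 \<ge> 0, so \<open>tail_sum_neg\<close> gives 0, in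
          agreement with \<open>bos\<close> at a negative argument.\<close>
        case False
        then have "tail_sum (replicate b 1) (L - r - 1) r = 0"
          using r \<open>L \<noteq> 0\<close> Suc.prems by (subst tail_sum_neg) auto
        then show ?thesis using False by (simp add: bos_eq_0)
      qed
      then show "x powi (r\<^sup>2 + 1 * r) * qbin' (2 * L + M - r) (M - r) *
        tail_sum (replicate b 1) (L - r - 1) r =
          x powi (r\<^sup>2 + r) * qbin (2 * L + M - r) (2 * L) * bos N (2 * int b + 3) 1 (L - 1 - r) r"
        using r Suc.prems by (simp add: qbin'_nonneg)
    qed
    also have "\<dots> = bos N (2 * int b + 3 + 2) 1 L M"
      using False Suc.prems by (intro bos_half_step) auto
    finally show ?thesis by (simp add: algebra_simps)
  qed
qed

text \<open>Each leading increment 0 is an ordinary Burge step, raising \<open>K\<close> by 2 and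
  \<open>i\<close> by 1 from the values (2b + 3, 1) of \<open>tail_sum_ones\<close>.\<close>

lemma tail_sum_bos:
  assumes "L \<ge> 0" "M \<ge> 0" "N > M"
  shows "tail_sum (replicate a 0 @ replicate b 1) L M =
    bos N (2 * (int a + int b) + 3) (int a + 1) L M"
  using assms
proof (induction a arbitrary: L M)
  case 0
  then show ?case by (simp add: tail_sum_ones)
next
  case (Suc a)
  let ?K = "2 * (int a + int b) + 3" and ?ds = "replicate a 0 @ replicate b 1"
  have "tail_sum (replicate (Suc a) 0 @ replicate b 1) L M =
      (\<Sum>r\<in>{0..M}. x powi r\<^sup>2 * qbin (2 * L + M - r) (2 * L) * bos N ?K (int a + 1) (L - r) r)"
    unfolding replicate_Suc append_Cons tail_sum.simps
  proof (intro sum.cong refl)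
    fix r assume r: "r \<in> {0..M}"
    have "tail_sum ?ds (L - r) r = bos N ?K (int a + 1) (L - r) r"
    proof (cases "r \<le> L")
      case True
      then show ?thesis using Suc.prems r by (intro Suc.IH) auto
    next
      case False
      then have "tail_sum ?ds (L - r) r = 0"
        using r Suc.prems by (subst tail_sum_neg) auto
      then show ?thesis using False by (simp add: bos_eq_0)
    qed
    then show "x powi (r\<^sup>2 + 0 * r) * qbin' (2 * L + M - r) (M - r) * tail_sum ?ds (L - r - 0) r =
        x powi r\<^sup>2 * qbin (2 * L + M - r) (2 * L) * bos N ?K (int a + 1) (L - r) r"
      using r Suc.prems by (simp add: qbin'_nonneg)
  qed
  also have "\<dots> = bos N (?K + 2) (int a + 1 + 1) L M"
    by (intro bos_burge) auto
  finally show ?case by (simp add: algebra_simps)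
qed

text \<open>The sum over n_1 carries no binomial of its own, since no variable precedes n_1; hence
  the limiting form of the Burge step.\<close>

lemma tail_sum_top_zero:
  assumes "n \<ge> 0" "N > n"
  shows "(\<Sum>r\<in>{0..n}. x powi r\<^sup>2 * tail_sum (replicate a 0 @ replicate b 1) (n - r) r) =
    bos_limit N (2 * (int a + int b) + 5) (int a + 2) n"
proof -
  have "(\<Sum>r\<in>{0..n}. x powi r\<^sup>2 * tail_sum (replicate a 0 @ replicate b 1) (n - r) r) =
      (\<Sum>r\<in>{0..n}. x powi r\<^sup>2 * bos N (2 * (int a + int b) + 3) (int a + 1) (n - r) r)"
    using assms by (intro sum.cong refl arg_cong2[where f = "(*)"] tail_sum_bos) auto
  also have "\<dots> = bos_limit N (2 * (int a + int b) + 3 + 2) (int a + 1 + 1) n"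
    by (intro bos_burge_limit) auto
  finally show ?thesis by (simp add: algebra_simps)
qed

lemma tail_sum_top_one:
  assumes "n \<ge> 0" "N > n"
  shows "(\<Sum>r\<in>{0..n}. x powi (r\<^sup>2 + r) * tail_sum (replicate b 1) (n - r - 1) r) =
    bos_limit N (2 * int b + 5) 1 n"
proof (cases "n = 0")
  case True
  then show ?thesis
    using assms bos_limit_at_0[of "2 * int b + 5" N] tail_sum_neg[of "-1" 0 "replicate b 1"] by simp
next
  case False
  have "(\<Sum>r\<in>{0..n}. x powi (r\<^sup>2 + r) * tail_sum (replicate b 1) (n - r - 1) r) =
      (\<Sum>r\<in>{0..n - 1}. x powi (r\<^sup>2 + r) * bos N (2 * int b + 3) 1 (n - 1 - r) r)"
  proof (rule sum.mono_neutral_cong_right)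
    \<comment> \<open>The one extra term \<open>r = n\<close> calls the tail at
      \<open>L = -1\<close> and \<open>M = n > 0\<close>, which is 0.\<close>
    show "\<forall>r\<in>{0..n} - {0..n - 1}. x powi (r\<^sup>2 + r) * tail_sum (replicate b 1) (n - r - 1) r = 0"
      using False assms by (auto simp: tail_sum_neg)
  next
    fix r assume "r \<in> {0..n - 1}"
    then have "tail_sum (replicate b 1) (n - 1 - r) r = bos N (2 * int b + 3) 1 (n - 1 - r) r"
      using assms by (intro tail_sum_ones) auto
    then show "x powi (r\<^sup>2 + r) * tail_sum (replicate b 1) (n - r - 1) r =
        x powi (r\<^sup>2 + r) * bos N (2 * int b + 3) 1 (n - 1 - r) r"
      by (simp add: algebra_simps)
  qed auto
  also have "\<dots> = bos_limit N (2 * int b + 3 + 2) 1 n"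
    using False assms by (intro bos_half_step_limit) auto
  finally show ?thesis by (simp add: algebra_simps)
qed

section \<open>Reduction of the sum over tuples to nested sums\<close>

definition fweight :: "nat \<Rightarrow> nat \<Rightarrow> (nat \<Rightarrow> nat) \<Rightarrow> 'a" where
  "fweight i j \<nu> = x ^ ((\<nu> j)\<^sup>2 + (if i \<le> j then \<nu> j else 0))"

definition ffactor :: "nat \<Rightarrow> nat \<Rightarrow> nat \<Rightarrow> (nat \<Rightarrow> nat) \<Rightarrow> 'a" where
  "ffactor i n j \<nu> = qbin' (2 * int n - 2 * (\<Sum>l\<in>{1..<j}. int (\<nu> l)) - int (\<nu> j) -
    int (\<nu> (j + 1)) - 2 * alpha i j)
     (int (\<nu> j) - int (\<nu> (j + 1)))"

text \<open>Descending induction on \<open>m\<close>: the coordinates up to \<open>m\<close> are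
  still free, the later ones are already summed inside \<open>tail_sum\<close>. Factor
  \<open>m\<close> involves \<nu> at \<open>m\<close> and \<open>m + 1\<close>, so it moves into the
  tail together with coordinate \<open>m + 1\<close>.\<close>

lemma sum_box_tail_sum:
  assumes "1 \<le> m" "m < k" "1 \<le> i"
  shows "(\<Sum>\<nu>\<in>box k n. (\<Prod>j\<in>{1..<k}. fweight i j \<nu>) * (\<Prod>j\<in>{1..<k}. ffactor i n j \<nu>)) =
    (\<Sum>\<nu>\<in>box (Suc m) n. (\<Prod>j\<in>{1..<Suc m}. fweight i j \<nu>) * (\<Prod>j\<in>{1..<m}. ffactor i n j \<nu>) *
      tail_sum (map (\<lambda>j. if i \<le> j then 1 else 0) [Suc m..<k]) (int n -
        (\<Sum>l\<in>{1..<Suc m}. int (\<nu> l)) - alpha i m) (int (\<nu> m)))"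
  using assms(1,2)
proof (induction "k - Suc m" arbitrary: m)
  case 0
  then have k: "k = Suc m" by simp
  show ?case
  proof (intro sum.cong)
    fix \<nu> assume \<nu>: "\<nu> \<in> box (Suc m) n"
    have "\<nu> (Suc m) = 0" using \<nu> by (simp add: box_def)
    then have "ffactor i n m \<nu> = qbin' (2 * (int n - (\<Sum>l\<in>{1..<Suc m}. int (\<nu> l)) - alpha i m) +
      int (\<nu> m)) (int (\<nu> m))"
      using 0 by (simp add: ffactor_def algebra_simps)
    moreover have "(\<Prod>j\<in>{1..<Suc m}. ffactor i n j \<nu>) = (\<Prod>j\<in>{1..<m}. ffactor i n j \<nu>) *
      ffactor i n m \<nu>"
      using 0 by (intro prod.atLeastLessThan_Suc) auto
    ultimately show "(\<Prod>j\<in>{1..<k}. fweight i j \<nu>) * (\<Prod>j\<in>{1..<k}. ffactor i n j \<nu>) =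
      (\<Prod>j\<in>{1..<Suc m}. fweight i j \<nu>) * (\<Prod>j\<in>{1..<m}. ffactor i n j \<nu>) *
      tail_sum (map (\<lambda>j. if i \<le> j then 1 else 0) [Suc m..<k]) (int n -
        (\<Sum>l\<in>{1..<Suc m}. int (\<nu> l)) - alpha i m) (int (\<nu> m))"
      unfolding k by (simp add: mult.assoc)
  qed (simp add: k)
next
  case (Suc d)
  define \<delta> where "\<delta> = (\<lambda>j. if i \<le> j then 1 else 0 :: int)"
  let ?ds = "map \<delta> [Suc (Suc m)..<k]"
  define Lm where "Lm = (\<lambda>\<nu>. int n - (\<Sum>l\<in>{1..<Suc m}. int (\<nu> l)) - alpha i m)"
  have "(\<Sum>\<nu>\<in>box k n. (\<Prod>j\<in>{1..<k}. fweight i j \<nu>) * (\<Prod>j\<in>{1..<k}. ffactor i n j \<nu>)) =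
    (\<Sum>\<nu>\<in>box (Suc (Suc m)) n. (\<Prod>j\<in>{1..<Suc (Suc m)}. fweight i j \<nu>) *
      (\<Prod>j\<in>{1..<Suc m}. ffactor i n j \<nu>) *
      tail_sum ?ds (int n - (\<Sum>l\<in>{1..<Suc (Suc m)}. int (\<nu> l)) - alpha i (Suc m)) (int (\<nu> (Suc m))))"
    unfolding \<delta>_def using Suc.hyps(2) Suc.prems by (intro Suc.hyps(1)) auto
  also have "\<dots> = (\<Sum>\<nu>\<in>box (Suc m) n. (\<Prod>j\<in>{1..<Suc m}. fweight i j \<nu>) *
    (\<Prod>j\<in>{1..<m}. ffactor i n j \<nu>) *
      tail_sum (\<delta> (Suc m) # ?ds) (Lm \<nu>) (int (\<nu> m)))"
    unfolding sum_box_Suc[of "Suc m", simplified]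
  proof (intro sum.cong refl)
    fix \<nu> assume \<nu>: "\<nu> \<in> box (Suc m) n"
    let ?A = "(\<Prod>j\<in>{1..<Suc m}. fweight i j \<nu>) * (\<Prod>j\<in>{1..<m}. ffactor i n j \<nu>)"
    let ?g = "\<lambda>r. x powi (r\<^sup>2 + \<delta> (Suc m) * r) *
      qbin' (2 * Lm \<nu> + int (\<nu> m) - r) (int (\<nu> m) - r) * tail_sum ?ds (Lm \<nu> - r - \<delta> (Suc m)) r"
    have le: "\<nu> m \<le> n" using \<nu> Suc.prems by (simp add: box_def)
    have summand: "(\<Prod>j\<in>{1..<Suc (Suc m)}. fweight i j (\<nu>(Suc m := r))) *
      (\<Prod>j\<in>{1..<Suc m}. ffactor i n j (\<nu>(Suc m := r))) *
      tail_sum ?ds (int n - (\<Sum>l\<in>{1..<Suc (Suc m)}. int ((\<nu>(Suc m := r)) l)) -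
        alpha i (Suc m)) (int ((\<nu>(Suc m := r)) (Suc m))) =
      ?A * ?g (int r)" for r
    proof -
      let ?\<nu> = "\<nu>(Suc m := r)"
      have s: "(\<Sum>l\<in>{1..<j}. int (?\<nu> l)) = (\<Sum>l\<in>{1..<j}. int (\<nu> l))" if "j \<le> Suc m" for j
        using that by (intro sum.cong) auto
      have 1: "(\<Prod>j\<in>{1..<Suc (Suc m)}. fweight i j ?\<nu>) = (\<Prod>j\<in>{1..<Suc m}. fweight i j \<nu>) *
        fweight i (Suc m) ?\<nu>"
      proof -
        have "(\<Prod>j\<in>{1..<Suc (Suc m)}. fweight i j ?\<nu>) = (\<Prod>j\<in>{1..<Suc m}. fweight i j ?\<nu>) *
          fweight i (Suc m) ?\<nu>"
          by (intro prod.atLeastLessThan_Suc) auto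
        also have "(\<Prod>j\<in>{1..<Suc m}. fweight i j ?\<nu>) = (\<Prod>j\<in>{1..<Suc m}. fweight i j \<nu>)"
          by (intro prod.cong) (auto simp: fweight_def)
        finally show ?thesis .
      qed
      have 2: "(\<Prod>j\<in>{1..<Suc m}. ffactor i n j ?\<nu>) = (\<Prod>j\<in>{1..<m}. ffactor i n j \<nu>) *
        ffactor i n m ?\<nu>"
      proof -
        have "(\<Prod>j\<in>{1..<Suc m}. ffactor i n j ?\<nu>) = (\<Prod>j\<in>{1..<m}. ffactor i n j ?\<nu>) *
          ffactor i n m ?\<nu>"
          using Suc.prems by (intro prod.atLeastLessThan_Suc) auto
        also have "(\<Prod>j\<in>{1..<m}. ffactor i n j ?\<nu>) = (\<Prod>j\<in>{1..<m}. ffactor i n j \<nu>)"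
          by (intro prod.cong refl) (simp add: ffactor_def s)
        finally show ?thesis .
      qed
      have 3: "fweight i (Suc m) ?\<nu> = x powi ((int r)\<^sup>2 + \<delta> (Suc m) * int r)"
      proof -
        have "(int r)\<^sup>2 + \<delta> (Suc m) * int r = int (r\<^sup>2 + (if i \<le> Suc m then r else 0))"
          by (simp add: \<delta>_def)
        then show ?thesis unfolding fweight_def by (simp only: power_int_of_nat fun_upd_same)
      qed
      have 4: "ffactor i n m ?\<nu> = qbin' (2 * Lm \<nu> + int (\<nu> m) - int r) (int (\<nu> m) - int r)"
        using Suc.prems by (simp add: ffactor_def s Lm_def algebra_simps)
      have 5: "int n - (\<Sum>l\<in>{1..<Suc (Suc m)}. int (?\<nu> l)) - alpha i (Suc m) = Lm \<nu> - int r -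
        \<delta> (Suc m)"
      proof -
        have "(\<Sum>l\<in>{1..<Suc (Suc m)}. int (?\<nu> l)) = (\<Sum>l\<in>{1..<Suc m}. int (?\<nu> l)) + int (?\<nu> (Suc m))"
          by (intro sum.atLeastLessThan_Suc) auto
        then show ?thesis using assms(3) by (simp add: s Lm_def alpha_Suc \<delta>_def)
      qed
      show ?thesis unfolding 1 2 3 4 5 by (simp add: mult_ac)
    qed
    have "(\<Sum>r\<in>{..n}. ?g (int r)) = (\<Sum>r\<in>{0..int n}. ?g r)"
      by (rule sum.reindex_bij_witness[where i = nat and j = int]) auto
    \<comment> \<open>Monotonicity reappears here: for r > \<nu> m the bottom is negative and the
      factor is 0.\<close>
    also have "\<dots> = (\<Sum>r\<in>{0..int (\<nu> m)}. ?g r)"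
      using le by (intro sum.mono_neutral_right) (auto simp: qbin'_def)
    finally show "(\<Sum>r\<in>{..n}. (\<Prod>j\<in>{1..<Suc (Suc m)}. fweight i j (\<nu>(Suc m := r))) *
      (\<Prod>j\<in>{1..<Suc m}. ffactor i n j (\<nu>(Suc m := r))) *
      tail_sum ?ds (int n - (\<Sum>l\<in>{1..<Suc (Suc m)}. int ((\<nu>(Suc m := r)) l)) -
        alpha i (Suc m)) (int ((\<nu>(Suc m := r)) (Suc m)))) =
      ?A * tail_sum (\<delta> (Suc m) # ?ds) (Lm \<nu>) (int (\<nu> m))"
      unfolding summand sum_distrib_left[symmetric] by simp
  qed
  also have "\<delta> (Suc m) # ?ds = map \<delta> [Suc m..<k]"
    using Suc.hyps(2) by (simp add: upt_conv_Cons)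
  finally show ?case by (simp only: Lm_def \<delta>_def)
qed

lemma sum_box_bos_limit:
  assumes "2 \<le> k" "1 \<le> i" "i \<le> k" "N > int n"
  shows "(\<Sum>\<nu>\<in>box k n. (\<Prod>j\<in>{1..<k}. fweight i j \<nu>) * (\<Prod>j\<in>{1..<k}. ffactor i n j \<nu>)) =
    bos_limit N (2 * int k + 1) (int i) (int n)"
proof -
  define \<delta> where "\<delta> = (\<lambda>j. if i \<le> j then 1 else 0 :: int)"
  let ?ds = "map \<delta> [2..<k]"
  have "(\<Sum>\<nu>\<in>box k n. (\<Prod>j\<in>{1..<k}. fweight i j \<nu>) * (\<Prod>j\<in>{1..<k}. ffactor i n j \<nu>)) =
    (\<Sum>r\<in>{..n}. x powi ((int r)\<^sup>2 + \<delta> 1 * int r) * tail_sum ?ds (int n - int r - \<delta> 1) (int r))"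
  proof -
    have a: "alpha i 1 = \<delta> 1" using assms by (auto simp: alpha_def \<delta>_def)
    have w: "fweight i 1 \<nu> = x powi ((int (\<nu> 1))\<^sup>2 + \<delta> 1 * int (\<nu> 1))" for \<nu>
    proof -
      have "(int (\<nu> 1))\<^sup>2 + \<delta> 1 * int (\<nu> 1) = int ((\<nu> 1)\<^sup>2 + (if i \<le> 1 then \<nu> 1 else 0))"
        by (simp add: \<delta>_def)
      then show ?thesis unfolding fweight_def by (simp only: power_int_of_nat)
    qed
    show ?thesis
      using sum_box_tail_sum[of 1 k i n] assms a w
      by (simp add: sum_box_Suc box_1 \<delta>_def[symmetric] numeral_2_eq_2)
  qed
  also have "\<dots> = (\<Sum>r\<in>{0..int n}. x powi (r\<^sup>2 + \<delta> 1 * r) * tail_sum ?ds (int n - r - \<delta> 1) r)"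
    by (rule sum.reindex_bij_witness[where i = nat and j = int]) auto
  also have "\<dots> = bos_limit N (2 * int k + 1) (int i) (int n)"
  \<comment> \<open>For \<open>i = 1\<close> all increments are 1, including that of n_1. Otherwise
    n_1 has increment 0 and is followed by \<open>i - 2\<close> zeros and \<open>k - i\<close>
    ones.\<close>
  proof (cases "i = 1")
    case True
    have "?ds = replicate (k - 2) 1"
      using True by (intro nth_equalityI) (auto simp: \<delta>_def)
    then show ?thesis
      using tail_sum_top_one[of "int n" N "k - 2"] assms True
        by (simp add: \<delta>_def algebra_simps of_nat_diff)
  next
    case False
    have "?ds = replicate (i - 2) 0 @ replicate (k - i) 1"
      using False assms by (intro nth_equalityI) (auto simp: \<delta>_def nth_append)
    then show ?thesis
      using tail_sum_top_zero[of "int n" N "i - 2" "k - i"] assms False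
        by (simp add: \<delta>_def algebra_simps of_nat_diff)
  qed
  finally show ?thesis .
qed

end

section \<open>Transfer to formal power series\<close>

lemma fps_to_fls_sum: "fps_to_fls (\<Sum>a\<in>A. f a) = (\<Sum>a\<in>A. fps_to_fls (f a))"
  by (induction A rule: infinite_finite_induct) simp_all

lemma fps_to_fls_prod: "fps_to_fls (\<Prod>a\<in>A. f a) = (\<Prod>a\<in>A. fps_to_fls (f a :: rat fps))"
  by (induction A rule: infinite_finite_induct) (simp_all add: fls_times_fps_to_fls)

text \<open>Identities proved over the Laurent series descend to power series because
  \<open>fps_to_fls\<close> is injective.\<close>

interpretation Q: q_base "fls_X :: rat fls"
proof
  show "(fls_X :: rat fls) ^ n \<noteq> 1" if "n > 0" for n :: nat
  proof
    assume "(fls_X :: rat fls) ^ n = 1"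
    then have "fps_to_fls (q ^ n) = 1" by (simp add: fps_to_fls_power)
    then have "q ^ n = 1" by (simp only: fps_to_fls_eq_1_iff)
    then have "(q ^ n) $ 0 = (1 :: rat fps) $ 0" by (simp only:)
    with that show False by simp
  qed
qed simp

lemma fps_to_fls_qpoch: "fps_to_fls (qpoch q q m) = Q.qfac (int m)"
  by (simp add: qpoch_def Q.qfac_def fps_to_fls_prod fls_times_fps_to_fls fps_to_fls_power)

lemma qpoch_nth_0: "qpoch q q m $ 0 = 1"
  by (induction m) (simp_all add: qpoch_def)

lemma fps_to_fls_qbinom: "fps_to_fls (qbinom a b) = Q.qbin a b"
proof (cases "0 \<le> b \<and> b \<le> a")
  case True
  let ?D = "qpoch q q (nat b) * qpoch q q (nat (a - b))"
  have D: "fps_to_fls ?D = Q.qfac b * Q.qfac (a - b)"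
    using True by (simp add: fls_times_fps_to_fls fps_to_fls_qpoch)
  \<comment> \<open>A constant term 1 makes the denominator a unit, so the division in
    \<open>qbinom\<close> is exact.\<close>
  have "?D $ 0 = 1" by (simp add: qpoch_nth_0)
  then have "is_unit ?D" by simp
  then have "qbinom a b * ?D = qpoch q q (nat a)"
    using True by (simp add: qbinom_def)
  then have "fps_to_fls (qbinom a b * ?D) = fps_to_fls (qpoch q q (nat a))" by (simp only:)
  then have "fps_to_fls (qbinom a b) * (Q.qfac b * Q.qfac (a - b)) = Q.qfac a"
    unfolding fls_times_fps_to_fls[of "qbinom a b"] D using True by (simp add: fps_to_fls_qpoch)
  then show ?thesis
    using True by (auto simp: Q.qbin_def field_simps)
next
  case False
  then show ?thesis by (auto simp: qbinom_def)
qed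

lemma fps_to_fls_qbinom': "fps_to_fls (qbinom' a b) = Q.qbin' a b"
  by (simp add: qbinom'_def Q.qbin'_def fps_to_fls_qbinom)

lemma fps_to_fls_lhs_term:
  assumes "1 \<le> i"
  shows "fps_to_fls (lhs_term k i n \<nu>) =
    (\<Prod>j\<in>{1..<k}. Q.fweight i j \<nu>) * (\<Prod>j\<in>{1..<k}. Q.ffactor i n j \<nu>)"
proof -
  have "(\<Sum>j\<in>{i..<k}. \<nu> j) = (\<Sum>j\<in>{1..<k}. if i \<le> j then \<nu> j else 0)"
    using assms by (intro sum.mono_neutral_cong_left) auto
  then have "(\<Prod>j\<in>{1..<k}. Q.fweight i j \<nu>) = fls_X ^ ((\<Sum>j\<in>{1..<k}. (\<nu> j)\<^sup>2) + (\<Sum>j\<in>{i..<k}. \<nu> j))"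
    by (simp add: Q.fweight_def power_sum[symmetric] sum.distrib)
  then show ?thesis
    by (simp add: lhs_term_def Q.ffactor_def fls_times_fps_to_fls fps_to_fls_power
      fps_to_fls_prod fps_to_fls_qbinom')
qed

lemma infsum_lhs_box: "infsum (lhs_term k i n) (tuples k) = sum (lhs_term k i n) (box k n)"
proof -
  have sub: "{\<nu> \<in> tuples k. lhs_term k i n \<nu> \<noteq> 0} \<subseteq> box k n"
  proof -
    have "\<nu> \<in> box k n" if \<nu>: "\<nu> \<in> tuples k" and nz: "lhs_term k i n \<nu> \<noteq> 0" for \<nu>
    proof -
      have zero: "\<nu> j = 0" if "j \<notin> {1..<k}" for j using \<nu> that by (auto simp: tuples_def)
      have "\<nu> j \<le> n" for j
      \<comment> \<open>Downward from \<nu> k = 0: either two neighbours are equal, or the nonzero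
        binomial forces 2 (\<nu> j) \<le> 2n.\<close>
      proof (induction "k - j" arbitrary: j)
        case 0
        then show ?case using zero[of j] by simp
      next
        case (Suc d)
        show ?case
        proof (cases "j \<in> {1..<k}")
          case True
          let ?a = "2 * int n - 2 * (\<Sum>l\<in>{1..<j}. int (\<nu> l)) - int (\<nu> j) - int (\<nu> (j + 1)) - 2 *
            alpha i j"
          have IH: "\<nu> (j + 1) \<le> n" using Suc.hyps by simp
          have "qbinom' ?a (int (\<nu> j) - int (\<nu> (j + 1))) \<noteq> 0"
            using nz True unfolding lhs_term_def by auto
          then have "\<nu> j = \<nu> (j + 1) \<or> int (\<nu> j) - int (\<nu> (j + 1)) \<le> ?a"
            by (auto simp: qbinom'_def qbinom_def split: if_splits)
          moreover have "(\<Sum>l\<in>{1..<j}. int (\<nu> l)) \<ge> 0" by (intro sum_nonneg) simp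
          moreover have "alpha i j \<ge> 0" by (simp add: alpha_def)
          ultimately show ?thesis using IH by linarith
        next
          case False
          then show ?thesis using zero by simp
        qed
      qed
      then show ?thesis using zero by (auto simp: box_def)
    qed
    then show ?thesis by auto
  qed
  have "lhs_term k i n \<nu> = 0" if "\<nu> \<in> box k n" "\<nu> \<notin> tuples k" for \<nu>
  proof -
    from that obtain j where j: "j \<in> {1..<k}" "\<nu> j < \<nu> (j + 1)"
      by (auto simp: box_def tuples_def not_le)
    then have "qbinom' a (int (\<nu> j) - int (\<nu> (j + 1))) = 0" for a
      by (simp add: qbinom'_def qbinom_def)
    then show ?thesis using j(1) unfolding lhs_term_def by (simp, intro disjI2 bexI[of _ j]) auto
  qed
  then show ?thesis
    unfolding infsum_lhs using sub finite_box by (intro sum.mono_neutral_left) auto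
qed

section \<open>The right-hand side as \<open>bos_limit\<close>\<close>

lemma fps_to_fls_rhs_term_even:
  assumes "1 \<le> i" "i \<le> k"
  shows "fps_to_fls (rhs_term k i n (2 * t)) =
    fls_X powi (t * (2 * (2 * int k + 1) * t + (2 * int k + 1) - 2 * int i)) *
      Q.qbin (2 * int n) (int n - (2 * int k + 1) * t)"
proof -
  have e: "rhs_exp k i (2 * t) = t * (2 * (2 * int k + 1) * t + (2 * int k + 1) - 2 * int i)"
  proof -
    have "2 * t * ((2 * int k + 1) * (2 * t) + 2 * int k - 2 * int i + 1) =
      2 * (t * (2 * (2 * int k + 1) * t + (2 * int k + 1) - 2 * int i))"
        by (simp add: algebra_simps)
    then show ?thesis unfolding rhs_exp_def by (simp only: nonzero_mult_div_cancel_left)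
  qed
  have "rhs_exp k i (2 * t) \<ge> 0" using rhs_exp_nonneg assms by blast
  then have "fls_X powi rhs_exp k i (2 * t) = (fls_X :: rat fls) ^ nat (rhs_exp k i (2 * t))"
    by (rule power_int_nonneg_exp)
  then show ?thesis
    unfolding e[symmetric]
    by (simp only: rhs_term_def neg_one_pow_def fls_times_fps_to_fls fps_to_fls_power
      fps_to_fls_qbinom
        rhs_idx_even fps_X_to_fls) simp
qed

lemma fps_to_fls_rhs_term_odd:
  assumes "1 \<le> i" "i \<le> k"
  shows "fps_to_fls (rhs_term k i n (2 * t - 1)) =
    - (fls_X powi ((2 * t - 1) * ((2 * int k + 1) * t - int i)) *
      Q.qbin (2 * int n) (int n - ((2 * int k + 1) * t - int i)))"
proof -
  have e: "rhs_exp k i (2 * t - 1) = (2 * t - 1) * ((2 * int k + 1) * t - int i)"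
  proof -
    have "(2 * t - 1) * ((2 * int k + 1) * (2 * t - 1) + 2 * int k - 2 * int i + 1) =
      2 * ((2 * t - 1) * ((2 * int k + 1) * t - int i))" by (simp add: algebra_simps)
    then show ?thesis unfolding rhs_exp_def by (simp only: nonzero_mult_div_cancel_left)
  qed
  have i: "rhs_idx k i n (2 * t - 1) = int n - ((2 * int k + 1) * t - int i)"
    using rhs_idx_odd[of k i n "t - 1"] by (simp add: algebra_simps)
  have "rhs_exp k i (2 * t - 1) \<ge> 0" using rhs_exp_nonneg assms by blast
  then have "fls_X powi rhs_exp k i (2 * t - 1) =
    (fls_X :: rat fls) ^ nat (rhs_exp k i (2 * t - 1))"
    by (rule power_int_nonneg_exp)
  then show ?thesis
    unfolding e[symmetric]
    by (simp only: rhs_term_def neg_one_pow_def fls_times_fps_to_fls fps_to_fls_power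
      fps_to_fls_qbinom
        i fps_X_to_fls) simp
qed

lemma fps_to_fls_infsum_rhs:
  assumes "1 \<le> i" "i \<le> k" "N > int n"
  shows "fps_to_fls (infsum (rhs_term k i n) UNIV) = Q.bos_limit N (2 * int k + 1) (int i) (int n)"
proof -
  let ?K = "2 * int k + 1"
  let ?A = "(\<lambda>t. 2 * t) ` {-N..N}" and ?B = "(\<lambda>t. 2 * t - 1) ` {-N..N}"
  have sub: "{r. rhs_term k i n r \<noteq> 0} \<subseteq> ?A \<union> ?B"
  proof
    fix r assume "r \<in> {r. rhs_term k i n r \<noteq> 0}"
    then have nz: "fps_to_fls (rhs_term k i n r) \<noteq> 0" by simp
    \<comment> \<open>A nonzero binomial bounds |Kt| by n + i, whereas |t| \<ge> n + 2 would give
      |Kt| \<ge> K (n + 2) > n + i.\<close>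
    have bound: "t \<in> {-N..N}" if "\<bar>?K * t\<bar> \<le> int n + int i" for t
    proof (rule ccontr)
      assume "t \<notin> {-N..N}"
      then have "\<bar>t\<bar> \<ge> int n + 2" using assms by auto
      then have "?K * (int n + 2) \<le> ?K * \<bar>t\<bar>" by (intro mult_left_mono) auto
      moreover have "?K * (int n + 2) = 2 * (int k * int n) + 4 * int k + int n + 2"
        by (simp add: algebra_simps)
      moreover have "int k * int n \<ge> 0" by (rule mult_nonneg_nonneg) auto
      moreover have "\<bar>?K * t\<bar> = ?K * \<bar>t\<bar>" by (simp add: abs_mult)
      ultimately show False using that assms by linarith
    qed
    show "r \<in> ?A \<union> ?B"
    proof (cases "even r")
      case True
      then obtain t where t: "r = 2 * t" by (elim evenE)
      have "\<bar>?K * t\<bar> \<le> int n + int i"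
        using nz unfolding t fps_to_fls_rhs_term_even[OF assms(1,2)]
        by (auto simp: Q.qbin_eq_0_iff not_less)
      then show ?thesis using bound t by auto
    next
      case False
      then obtain t where t: "r = 2 * (t + 1) - 1" by (elim oddE) (auto simp: algebra_simps)
      have "\<bar>?K * (t + 1)\<bar> \<le> int n + int i"
        using nz unfolding t fps_to_fls_rhs_term_odd[OF assms(1,2)]
        by (auto simp: Q.qbin_eq_0_iff not_less)
      then have "t + 1 \<in> {-N..N}" by (rule bound)
      then have "r \<in> ?B" unfolding t by (rule imageI)
      then show ?thesis by blast
    qed
  qed
  have disj: "?A \<inter> ?B = {}"
  proof -
    have "2 * s \<noteq> 2 * t - 1" for s t :: int by presburger
    then show ?thesis by blast
  qed
  have "infsum (rhs_term k i n) UNIV = sum (rhs_term k i n) (?A \<union> ?B)"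
    unfolding infsum_rhs using sub by (intro sum.mono_neutral_left) auto
  also have "\<dots> = sum (rhs_term k i n) ?A + sum (rhs_term k i n) ?B"
    using disj by (intro sum.union_disjoint) auto
  also have "\<dots> = (\<Sum>t\<in>{-N..N}. rhs_term k i n (2 * t)) + (\<Sum>t\<in>{-N..N}. rhs_term k i n (2 * t - 1))"
    by (subst (1 2) sum.reindex) (auto simp: inj_on_def)
  finally show ?thesis
    by (simp add: fps_to_fls_sum fps_to_fls_rhs_term_even[OF assms(1,2)]
      fps_to_fls_rhs_term_odd[OF assms(1,2)]
        Q.bos_limit_def sum_subtractf sum_negf)
qed

theorem finite_Andrews_Gordon:
  assumes "2 \<le> k" "1 \<le> i" "i \<le> k"
  shows "(\<Sum>\<^sub>\<infinity>\<nu>\<in>tuples k. lhs_term k i n \<nu>) = (\<Sum>\<^sub>\<infinity>r\<in>UNIV. rhs_term k i n r)"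
proof -
  have "fps_to_fls (infsum (lhs_term k i n) (tuples k)) = fps_to_fls (infsum (rhs_term k i n) UNIV)"
    using assms Q.sum_box_bos_limit[of k i n "int n + 1"] fps_to_fls_infsum_rhs[of i k n "int n +
      1"]
    by (simp add: infsum_lhs_box fps_to_fls_sum fps_to_fls_lhs_term)
  then show ?thesis by simp
qed

section \<open>Cylindric partitions\<close>

context q_base
begin

text \<open>The generating function of pairs of partitions with at most \<open>a\<close> and
  \<open>b\<close> parts and no interlacing condition.\<close>

definition pair_gf :: "int \<Rightarrow> int \<Rightarrow> 'a" where
  "pair_gf a b = inverse (qfac a) * inverse (qfac b)"

lemma pair_gf_eq_0 [simp]: "a < 0 \<or> b < 0 \<Longrightarrow> pair_gf a b = 0"
  by (auto simp: pair_gf_def)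

lemma pair_gf_swap: "pair_gf a b = pair_gf b a"
  by (simp add: pair_gf_def mult.commute)

lemma pair_gf_minus1:
  "pair_gf (a - 1) b = (1 - x powi a) * pair_gf a b" "pair_gf a (b - 1) = (1 - x powi b) *
    pair_gf a b"
  by (simp_all add: pair_gf_def inverse_qfac_rec)

text \<open>
  The alternating sum of the shifts of \<^term>\<open>pair_gf\<close> along \<open>a + b\<close> = const obtained
    by reflecting in the
  two lines \<open>a - b = - i\<close> and \<open>a - b = K - i\<close>.
\<close>

definition cyl_sum :: "int \<Rightarrow> int \<Rightarrow> int \<Rightarrow> int \<Rightarrow> int \<Rightarrow> 'a" where
  "cyl_sum N K i a b = (\<Sum>t\<in>{-N..N}.
     x powi (t * (2 * K * t + K - 2 * i)) * pair_gf (a + K * t) (b - K * t) -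
     x powi ((2 * t - 1) * (K * t - i)) * pair_gf (a + i - K * t) (b - i + K * t))"

text \<open>With A = x^a and B = x^b this is 1 - AB = (1 - A) + (1 - B) - (1 - A)(1 - B).\<close>

lemma pair_gf_rec:
  "(1 - x powi (a + b)) * pair_gf a b = pair_gf (a - 1) b + pair_gf a (b - 1) -
    pair_gf (a - 1) (b - 1)"
  by (simp add: pair_gf_minus1 powi_add[symmetric] algebra_simps)

lemma cyl_sum_rec:
  "(1 - x powi (a + b)) * cyl_sum N K i a b =
    cyl_sum N K i (a - 1) b + cyl_sum N K i a (b - 1) - cyl_sum N K i (a - 1) (b - 1)"
proof -
  have 1: "(1 - x powi (a + b)) * pair_gf (a + c) (b - c) =
      pair_gf (a - 1 + c) (b - c) + pair_gf (a + c) (b - 1 - c) -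
        pair_gf (a - 1 + c) (b - 1 - c)" for c
    using pair_gf_rec[of "a + c" "b - c"] by (simp add: algebra_simps)
  have 2: "(1 - x powi (a + b)) * pair_gf (a + i - c) (b - i + c) =
      pair_gf (a - 1 + i - c) (b - i + c) + pair_gf (a + i - c) (b - 1 - i + c) -
        pair_gf (a - 1 + i - c) (b - 1 - i + c)" for c
    using pair_gf_rec[of "a + i - c" "b - i + c"] by (simp add: algebra_simps)
  show ?thesis
    unfolding cyl_sum_def sum_distrib_left right_diff_distrib mult.left_commute[of "1 - _"] 1 2
      sum_subtractf[symmetric] sum.distrib[symmetric]
    by (intro sum.cong refl) (simp add: algebra_simps)
qed

text \<open>On this line the direct and the reflected term with the same t have equal
  \<open>pair_gf\<close> by symmetry, so their changes under b \<mapsto> b - 1 cancel.\<close>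

lemma cyl_sum_left_boundary:
  assumes "b = a + i"
  shows "cyl_sum N K i a b = cyl_sum N K i a (b - 1)"
proof -
  have "cyl_sum N K i a b - cyl_sum N K i a (b - 1) = (\<Sum>t\<in>{-N..N}. 0)"
    unfolding cyl_sum_def sum_subtractf[symmetric]
  proof (intro sum.cong refl)
    fix t
    have d1: "pair_gf (a + K * t) (b - 1 - K * t) = (1 - x powi (b - K * t)) *
      pair_gf (a + K * t) (b - K * t)"
      using pair_gf_minus1(2)[of "a + K * t" "b - K * t"] by (simp add: algebra_simps)
    have d2: "pair_gf (a + i - K * t) (b - 1 - i + K * t) = (1 - x powi (b - i + K * t)) *
      pair_gf (a + i - K * t) (b - i + K * t)"
      using pair_gf_minus1(2)[of "a + i - K * t" "b - i + K * t"] by (simp add: algebra_simps)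
    have e: "x powi (t * (2 * K * t + K - 2 * i)) * x powi (b - K * t) =
      x powi ((2 * t - 1) * (K * t - i)) * x powi (b - i + K * t)"
      unfolding powi_add by (rule arg_cong[where f = "power_int x"]) (simp add: algebra_simps)
    have h: "pair_gf (a + i - K * t) (b - i + K * t) = pair_gf (a + K * t) (b - K * t)"
      using assms by (simp add: pair_gf_swap[of "a + i - K * t"])
    show "x powi (t * (2 * K * t + K - 2 * i)) * pair_gf (a + K * t) (b - K * t) -
        x powi ((2 * t - 1) * (K * t - i)) * pair_gf (a + i - K * t) (b - i + K * t) -
        (x powi (t * (2 * K * t + K - 2 * i)) * pair_gf (a + K * t) (b - 1 - K * t) -
         x powi ((2 * t - 1) * (K * t - i)) * pair_gf (a + i - K * t) (b - 1 - i + K * t)) = 0"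
      unfolding d1 d2 h using arg_cong[OF e, of "\<lambda>z. z * pair_gf (a + K * t) (b - K * t)"]
      by (simp add: algebra_simps)
  qed
  then show ?thesis by simp
qed

text \<open>On this line the direct term at t matches the reflected one at t + 1, so the difference
  telescopes; \<open>N > b\<close> makes both end terms vanish.\<close>

lemma cyl_sum_right_boundary:
  assumes "a = b + K - i" "K \<ge> 1" "i \<ge> 0" "N > b" "N \<ge> 0"
  shows "cyl_sum N K i a b = cyl_sum N K i (a - 1) b"
proof -
  define v where "v = (\<lambda>t. x powi ((2 * t - 1) * (K * t - i)) * x powi (a + i - K * t) *
    pair_gf (a + i - K * t) (b - i + K * t))"
  have "cyl_sum N K i (a - 1) b - cyl_sum N K i a b = (\<Sum>t\<in>{-N..N}. v t - v (t + 1))"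
    unfolding cyl_sum_def sum_subtractf[symmetric]
  proof (intro sum.cong refl)
    fix t
    have d1: "pair_gf (a - 1 + K * t) (b - K * t) = (1 - x powi (a + K * t)) *
      pair_gf (a + K * t) (b - K * t)"
      using pair_gf_minus1(1)[of "a + K * t" "b - K * t"] by (simp add: algebra_simps)
    have d2: "pair_gf (a - 1 + i - K * t) (b - i + K * t) = (1 - x powi (a + i - K * t)) *
      pair_gf (a + i - K * t) (b - i + K * t)"
      using pair_gf_minus1(1)[of "a + i - K * t" "b - i + K * t"] by (simp add: algebra_simps)
    have "x powi ((2 * (t + 1) - 1) * (K * (t + 1) - i)) * x powi (a + i - K * (t + 1)) =
      x powi (t * (2 * K * t + K - 2 * i)) * x powi (a + K * t)"
      unfolding powi_add by (rule arg_cong[where f = "power_int x"]) (simp add: algebra_simps)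
    moreover have "pair_gf (a + i - K * (t + 1)) (b - i + K * (t + 1)) =
      pair_gf (a + K * t) (b - K * t)"
    proof -
      have "a + i - K * (t + 1) = b - K * t" "b - i + K * (t + 1) = a + K * t"
        using assms(1) by (simp_all add: algebra_simps)
      then show ?thesis by (simp only: pair_gf_swap[of "b - K * t"])
    qed
    ultimately have v1: "v (t + 1) = x powi (t * (2 * K * t + K - 2 * i)) * x powi (a + K * t) *
      pair_gf (a + K * t) (b - K * t)"
      by (simp only: v_def)
    show "x powi (t * (2 * K * t + K - 2 * i)) * pair_gf (a - 1 + K * t) (b - K * t) -
         x powi ((2 * t - 1) * (K * t - i)) * pair_gf (a - 1 + i - K * t) (b - i + K * t) -
         (x powi (t * (2 * K * t + K - 2 * i)) * pair_gf (a + K * t) (b - K * t) -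
          x powi ((2 * t - 1) * (K * t - i)) * pair_gf (a + i - K * t) (b - i + K * t)) = v t -
            v (t + 1)"
      unfolding d1 d2 v1 unfolding v_def by (simp add: algebra_simps)
  qed
  also have "\<dots> = v (- N) - v (N + 1)"
    using assms by (intro sum_int_telescope) auto
  also have "\<dots> = 0"
  proof -
    have KN: "K * N \<ge> N" using assms mult_right_mono[of 1 K N] by simp
    have "b - i + K * (- N) < 0" "a + i - K * (N + 1) < 0"
      using KN assms by (auto simp: algebra_simps)
    then show ?thesis by (simp add: v_def)
  qed
  finally show ?thesis by simp
qed

text \<open>In the strip a < 0 forces b < i, and b < 0 forces a < K - i. No shifted or reflected
  image of the point then has both coordinates nonnegative.\<close>

lemma cyl_sum_eq_0:
  assumes "a < 0 \<or> b < 0" "0 < i" "i < K" "- i \<le> a - b" "a - b \<le> K - i"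
  shows "cyl_sum N K i a b = 0"
proof -
  have "a + K * t < 0 \<or> b - K * t < 0" for t
  proof (rule ccontr)
    assume "\<not> ?thesis"
    then have "a + K * t \<ge> 0" "K * t \<le> b" by auto
    then have "\<bar>K * t\<bar> < K" "K * t \<noteq> 0" using assms by linarith+
    moreover from this have "K * 1 \<le> K * \<bar>t\<bar>" using assms by (intro mult_left_mono) auto
    ultimately show False using assms by (simp add: abs_mult)
  qed
  moreover have "a + i - K * t < 0 \<or> b - i + K * t < 0" for t
  proof (rule ccontr)
    assume "\<not> ?thesis"
    then have h: "K * t \<le> a + i" "i - b \<le> K * t" by linarith+
    consider "t \<ge> 1" | "t \<le> 0" by linarith
    then show False
    proof cases
      case 1
      then have "K * t \<ge> K * 1" using assms by (intro mult_left_mono) auto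
      then show False using h assms by linarith
    next
      case 2
      then have "K * t \<le> K * 0" using assms by (intro mult_left_mono) auto
      then show False using h assms by linarith
    qed
  qed
  ultimately show ?thesis by (simp add: cyl_sum_def)
qed

lemma cyl_sum_0_0:
  assumes "0 < i" "i < K" "N \<ge> 0"
  shows "cyl_sum N K i 0 0 = 1"
proof -
  have "cyl_sum N K i 0 0 = (\<Sum>t\<in>{-N..N}. if t = 0 then 1 else 0)"
    unfolding cyl_sum_def
  proof (intro sum.cong refl)
    fix t
    have "K * t \<noteq> i"
    proof
      assume "K * t = i"
      then have "K dvd i" by auto
      then show False using assms zdvd_imp_le by fastforce
    qed
    then have "pair_gf (0 + i - K * t) (0 - i + K * t) = 0" by (intro pair_gf_eq_0) linarith
    moreover have "pair_gf (0 + K * t) (0 - K * t) = (if t = 0 then 1 else 0)"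
      using assms by (auto simp: pair_gf_def linorder_neq_iff mult_less_0_iff zero_less_mult_iff)
    ultimately show "x powi (t * (2 * K * t + K - 2 * i)) * pair_gf (0 + K * t) (0 - K * t) -
        x powi ((2 * t - 1) * (K * t - i)) * pair_gf (0 + i - K * t) (0 - i + K * t) =
          (if t = 0 then 1 else 0)"
      by simp
  qed
  also have "\<dots> = 1" using assms by simp
  finally show ?thesis .
qed

lemma cyl_sum_diagonal:
  assumes "n \<ge> 0"
  shows "cyl_sum N K i n n = inverse (qfac (2 * n)) * bos_limit N K i n"
proof -
  have *: "inverse (qfac (2 * n)) * qbin (2 * n) (n - c) = pair_gf (n + c) (n - c)" for c
    using assms by (simp add: qbin_inverse pair_gf_def algebra_simps)
  show ?thesis
    unfolding cyl_sum_def bos_limit_def sum_distrib_left right_diff_distrib[of "inverse _"]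
      mult.left_commute[of "inverse _"] *
  proof (intro sum.cong refl)
    fix t
    show "x powi (t * (2 * K * t + K - 2 * i)) * pair_gf (n + K * t) (n - K * t) -
        x powi ((2 * t - 1) * (K * t - i)) * pair_gf (n + i - K * t) (n - i + K * t) =
        x powi (t * (2 * K * t + K - 2 * i)) * pair_gf (n + K * t) (n - K * t) -
        x powi ((2 * t - 1) * (K * t - i)) * pair_gf (n + (K * t - i)) (n - (K * t - i))"
      using pair_gf_swap[of "n + i - K * t"] by (simp add: algebra_simps)
  qed
qed

end

text \<open>Separate integer bounds on the numbers of parts let the recurrence run down to -1, where
  the set is empty.\<close>

definition cyl_set :: "nat \<Rightarrow> nat \<Rightarrow> int \<Rightarrow> int \<Rightarrow> nat \<Rightarrow> (nat list \<times> nat list) set" where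
  "cyl_set c1 c2 a b m = {(xs, ys). cylindric_partition c1 c2 (xs, ys) \<and> int (length xs) \<le> a \<and>
    int (length ys) \<le> b
     \<and> sum_list xs + sum_list ys = m}"

definition cyl_gf :: "nat \<Rightarrow> nat \<Rightarrow> int \<Rightarrow> int \<Rightarrow> rat fps" where
  "cyl_gf c1 c2 a b = Abs_fps (\<lambda>m. of_nat (card (cyl_set c1 c2 a b m)))"

lemma finite_cyl_set: "finite (cyl_set c1 c2 a b m)"
proof (rule finite_subset)
  show "cyl_set c1 c2 a b m \<subseteq> {(xs, ys). cylindric_partition c1 c2 (xs, ys) \<and>
      length xs \<le> nat (max a b) \<and> length ys \<le> nat (max a b) \<and> sum_list xs + sum_list ys = m}"
    by (auto simp: cyl_set_def)
qed (rule finite_CP)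

lemma CP_eq_cyl_gf: "CP a b n = cyl_gf a b (int n) (int n)"
  by (simp add: CP_def cyl_gf_def cyl_set_def)

lemma cyl_gf_neg: "a < 0 \<or> b < 0 \<Longrightarrow> cyl_gf c1 c2 a b = 0"
  by (auto simp: cyl_gf_def cyl_set_def fps_eq_iff)

section \<open>Boundary rules and recurrence for cylindric partitions\<close>

lemma part_pos:
  assumes "is_partition xs" "1 \<le> j" "j \<le> length xs"
  shows "part xs j > 0"
proof -
  have "part xs j \<in> set xs" using assms by (simp add: part_def)
  then show ?thesis using assms(1) by (auto simp: is_partition_def intro: gr0I)
qed

text \<open>Interlacing at j = \<open>length xs + 1\<close>, where the part of \<open>xs\<close> is
  0, shows that \<open>ys\<close> has at most \<open>length xs + c2\<close> parts.\<close>

lemma cyl_gf_left_boundary: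
  assumes "b = a + int c2 + 1"
  shows "cyl_gf c1 c2 a b = cyl_gf c1 c2 a (b - 1)"
proof -
  have "int (length ys) \<le> b - 1"
    if "cylindric_partition c1 c2 (xs, ys)" "int (length xs) \<le> a" for xs ys
  proof (rule ccontr)
    assume h: "\<not> ?thesis"
    have "part ys (Suc (length xs) + c2) > 0"
      using that h assms by (intro part_pos) (auto simp: cylindric_partition_def)
    moreover have "\<forall>j\<ge>1. part ys (j + c2) \<le> part xs j"
      using that(1) by (simp add: cylindric_partition_def)
    then have "part ys (Suc (length xs) + c2) \<le> part xs (Suc (length xs))"
      by (elim allE[of _ "Suc (length xs)"]) simp
    ultimately show False by (simp add: part_def)
  qed
  then have "cyl_set c1 c2 a b m = cyl_set c1 c2 a (b - 1) m" for m
    by (fastforce simp: cyl_set_def)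
  then show ?thesis by (simp add: cyl_gf_def)
qed

lemma cyl_gf_right_boundary:
  assumes "a = b + int c1 + 1"
  shows "cyl_gf c1 c2 a b = cyl_gf c1 c2 (a - 1) b"
proof -
  have "int (length xs) \<le> a - 1"
    if "cylindric_partition c1 c2 (xs, ys)" "int (length ys) \<le> b" for xs ys
  proof (rule ccontr)
    assume h: "\<not> ?thesis"
    have "part xs (Suc (length ys) + c1) > 0"
      using that h assms by (intro part_pos) (auto simp: cylindric_partition_def)
    moreover have "\<forall>j\<ge>1. part xs (j + c1) \<le> part ys j"
      using that(1) by (simp add: cylindric_partition_def)
    then have "part xs (Suc (length ys) + c1) \<le> part ys (Suc (length ys))"
      by (elim allE[of _ "Suc (length ys)"]) simp
    ultimately show False by (simp add: part_def)
  qed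
  then have "cyl_set c1 c2 a b m = cyl_set c1 c2 (a - 1) b m" for m
    by (fastforce simp: cyl_set_def)
  then show ?thesis by (simp add: cyl_gf_def)
qed

text \<open>Padding with zeros before adding 1 adjoins a first column of height \<open>a\<close> to
  the Young diagram, even when \<open>xs\<close> has fewer than \<open>a\<close> parts.\<close>

definition add_column :: "nat \<Rightarrow> nat list \<Rightarrow> nat list" where
  "add_column a xs = map Suc (xs @ replicate (a - length xs) 0)"

definition remove_column :: "nat list \<Rightarrow> nat list" where
  "remove_column xs = filter (\<lambda>x. x \<noteq> 0) (map (\<lambda>x. x - 1) xs)"

lemma add_column_props:
  assumes "is_partition xs" "length xs \<le> a"
  shows "is_partition (add_column a xs)" "length (add_column a xs) = a"
    "sum_list (add_column a xs) = sum_list xs + a"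
    "part (add_column a xs) j = (if 1 \<le> j \<and> j \<le> a then part xs j + 1 else 0)"
    "remove_column (add_column a xs) = xs"
proof -
  have "sorted_wrt (\<ge>) (replicate k (0 :: nat))" for k by (induction k) auto
  then show "is_partition (add_column a xs)"
    using assms by (auto simp: is_partition_def add_column_def sorted_wrt_append sorted_wrt_map
      simp del: map_append map_replicate)
  show "length (add_column a xs) = a" using assms by (simp add: add_column_def)
  have "sum_list (map Suc zs) = sum_list zs + length zs" for zs by (induction zs) auto
  then show "sum_list (add_column a xs) = sum_list xs + a"
    using assms by (simp add: add_column_def sum_list_replicate del: map_append)
  show "part (add_column a xs) j = (if 1 \<le> j \<and> j \<le> a then part xs j + 1 else 0)"
    using assms by (auto simp: part_def add_column_def nth_append)
  show "remove_column (add_column a xs) = xs"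
  proof -
    have "filter (\<lambda>x. x \<noteq> 0) xs = xs"
      using assms(1) by (auto simp: is_partition_def filter_id_conv intro: gr0I)
    then show ?thesis by (simp add: remove_column_def add_column_def comp_def)
  qed
qed

lemma sorted_nonzero_append_zeros:
  fixes zs :: "nat list"
  assumes "sorted_wrt (\<ge>) zs"
  shows "filter (\<lambda>x. x \<noteq> 0) zs @ replicate (length zs - length (filter (\<lambda>x. x \<noteq> 0) zs)) 0 = zs"
  using assms
proof (induction zs)
  case (Cons z zs)
  show ?case
  proof (cases "z = 0")
    case True
    then have "\<forall>y\<in>set (z # zs). y = 0" using Cons.prems by auto
    then show ?thesis by (metis (mono_tags, lifting) append_Nil diff_zero filter_False
      list.size(3) replicate_length_same)
  next
    case False
    then show ?thesis using Cons by simp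
  qed
qed simp

lemma remove_column_props:
  assumes "is_partition xs"
  shows "is_partition (remove_column xs)" "length (remove_column xs) \<le> length xs"
    "add_column (length xs) (remove_column xs) = xs"
    "part (remove_column xs) j = part xs j - 1"
    "sum_list xs = sum_list (remove_column xs) + length xs"
proof -
  have s: "sorted_wrt (\<ge>) (map (\<lambda>x. x - 1) xs)"
    using assms by (auto simp: is_partition_def sorted_wrt_map intro: sorted_wrt_mono_rel[rotated])
  show p: "is_partition (remove_column xs)"
    using s by (auto simp: is_partition_def remove_column_def sorted_wrt_filter)
  show l: "length (remove_column xs) \<le> length xs"
    using length_filter_le[of _ "map (\<lambda>x. x - 1) xs"] by (simp add: remove_column_def)
  have "map Suc (map (\<lambda>x. x - 1) xs) = xs"
    using assms by (auto simp: is_partition_def intro!: map_idI) (metis Suc_pred neq0_conv)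
  then show a: "add_column (length xs) (remove_column xs) = xs"
    using sorted_nonzero_append_zeros[OF s] unfolding add_column_def remove_column_def by simp
  show "part (remove_column xs) j = part xs j - 1"
  proof (cases "1 \<le> j \<and> j \<le> length xs")
    case True
    then show ?thesis using add_column_props(4)[OF p l, of j] a by simp
  next
    case False
    then show ?thesis using l by (auto simp: part_def)
  qed
  show "sum_list xs = sum_list (remove_column xs) + length xs"
    using add_column_props(3)[OF p l] a by simp
qed

text \<open>Removing the first columns always preserves interlacing. Adding them does so because b
  \<le> a + c2 and a \<le> b + c1 guarantee that whenever the smaller part of an inequality grows,
  the larger one grows too.\<close>

lemma card_full_columns:
  assumes "b \<le> a + c2" "a \<le> b + c1"
  shows "card {(xs, ys). cylindric_partition c1 c2 (xs, ys) \<and> length xs = a \<and> length ys = b \<and>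
    sum_list xs + sum_list ys = m + (a + b)} =
    card (cyl_set c1 c2 (int a) (int b) m)" (is "card ?E = card ?S")
proof -
  have "bij_betw (\<lambda>(xs, ys). (remove_column xs, remove_column ys)) ?E ?S"
  proof (rule bij_betw_byWitness[where f' = "\<lambda>(xs, ys). (add_column a xs, add_column b ys)"])
    show "\<forall>p\<in>?E. (\<lambda>(xs, ys). (add_column a xs,
      add_column b ys)) ((\<lambda>(xs, ys). (remove_column xs, remove_column ys)) p) = p"
      by (auto simp: cylindric_partition_def remove_column_props(3))
    show "\<forall>p\<in>?S. (\<lambda>(xs, ys). (remove_column xs,
      remove_column ys)) ((\<lambda>(xs, ys). (add_column a xs, add_column b ys)) p) = p"
      by (auto simp: cyl_set_def cylindric_partition_def add_column_props(5))
    show "(\<lambda>(xs, ys). (remove_column xs, remove_column ys)) ` ?E \<subseteq> ?S"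
      by (auto simp: cyl_set_def cylindric_partition_def remove_column_props diff_le_mono)
    show "(\<lambda>(xs, ys). (add_column a xs, add_column b ys)) ` ?S \<subseteq> ?E"
      using assms by (auto simp: cyl_set_def cylindric_partition_def add_column_props)
  qed
  then show ?thesis by (rule bij_betw_same_card)
qed

text \<open>Inclusion-exclusion: either both bounds are attained, and full columns of total size a +
  b can be removed, or one bound can be lowered by 1.\<close>

lemma cyl_gf_rec:
  assumes "a \<ge> 0" "b \<ge> 0" "b \<le> a + int c2" "a \<le> b + int c1"
  shows "cyl_gf c1 c2 a b = q ^ nat (a + b) * cyl_gf c1 c2 a b + cyl_gf c1 c2 (a - 1) b +
    cyl_gf c1 c2 a (b - 1) - cyl_gf c1 c2 (a - 1) (b - 1)"
proof (rule fps_ext)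
  fix m
  let ?E = "{(xs, ys). cylindric_partition c1 c2 (xs, ys) \<and> length xs = nat a \<and> length ys =
    nat b \<and> sum_list xs + sum_list ys = m}"
  let ?S = "\<lambda>a b. cyl_set c1 c2 a b m"
  have U: "?S a b = ?E \<union> (?S (a - 1) b \<union> ?S a (b - 1))"
    using assms by (auto simp: cyl_set_def)
  have finE: "finite ?E"
    by (rule finite_subset[OF _ finite_cyl_set[of c1 c2 a b m]])
      (use assms in \<open>auto simp: cyl_set_def\<close>)
  have I: "?S (a - 1) b \<inter> ?S a (b - 1) = ?S (a - 1) (b - 1)"
    by (auto simp: cyl_set_def)
  have "card (?S a b) = card ?E + card (?S (a - 1) b \<union> ?S a (b - 1))"
  proof -
    have "?E \<inter> (?S (a - 1) b \<union> ?S a (b - 1)) = {}"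
      using assms by (auto simp: cyl_set_def split: if_splits)
    then show ?thesis unfolding U using finE finite_cyl_set by (intro card_Un_disjoint) auto
  qed
  moreover have "card (?S (a - 1) b) + card (?S a (b - 1)) = card (?S (a - 1) b \<union> ?S a (b - 1)) +
    card (?S (a - 1) (b - 1))"
    using card_Un_Int[of "?S (a - 1) b" "?S a (b - 1)"] finite_cyl_set I by simp
  moreover have "card ?E = (if m < nat (a + b) then 0 else card (cyl_set c1 c2 a b (m -
    nat (a + b))))"
  proof (cases "m < nat (a + b)")
    case True
    have "nat a + nat b \<le> m" if "(xs, ys) \<in> ?E" for xs ys
      using that remove_column_props(5)[of xs] remove_column_props(5)[of ys]
      by (auto simp: cylindric_partition_def)
    then have "?E = {}" using True assms by (auto simp: nat_add_distrib)
    then have "card ?E = 0" by (simp only: card.empty)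
    then show ?thesis using True by simp
  next
    case False
    then have "m = (m - nat (a + b)) + (nat a + nat b)" using assms by (simp add: nat_add_distrib)
    then show ?thesis
      using card_full_columns[of "nat b" "nat a" c2 c1 "m - nat (a + b)"] assms False
        by (simp add: nat_le_iff)
  qed
  ultimately have "of_nat (card (?S a b)) = (if m < nat (a +
    b) then 0 else of_nat (card (cyl_set c1 c2 a b (m - nat (a + b))))) +
     of_nat (card (?S (a - 1) b)) + of_nat (card (?S a (b - 1))) -
       (of_nat (card (?S (a - 1) (b - 1))) :: rat)"
    by (auto simp flip: of_nat_add simp: algebra_simps)
  then show "cyl_gf c1 c2 a b $ m = (q ^ nat (a + b) * cyl_gf c1 c2 a b +
    cyl_gf c1 c2 (a - 1) b + cyl_gf c1 c2 a (b - 1) - cyl_gf c1 c2 (a - 1) (b - 1)) $ m"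
    by (simp add: cyl_gf_def fps_X_power_mult_nth)
qed

text \<open>Induction on a + b over the strip widened by one line on each side. The parameters put
  the two reflection lines at a - b = -(c2 + 1) and a - b = c1 + 1, where the boundary rules apply;
  inside, both sides obey the same recurrence.\<close>

lemma cyl_gf_eq_cyl_sum:
  assumes "- int c2 - 1 \<le> a - b" "a - b \<le> int c1 + 1" "b < N" "N \<ge> 0"
  shows "fps_to_fls (cyl_gf c1 c2 a b) = Q.cyl_sum N (int c1 + int c2 + 2) (int c2 + 1) a b"
  using assms
proof (induction "nat (a + b + 1)" arbitrary: a b rule: less_induct)
  case less
  let ?K = "int c1 + int c2 + 2" and ?i = "int c2 + 1"
  let ?H = "\<lambda>a b. fps_to_fls (cyl_gf c1 c2 a b)" and ?B = "Q.cyl_sum N ?K ?i"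
  show ?case
  proof (cases "a < 0 \<or> b < 0")
    case True
    then show ?thesis using less.prems by (simp add: cyl_gf_neg Q.cyl_sum_eq_0)
  next
    case False
    then have ab: "a \<ge> 0" "b \<ge> 0" by auto
    consider "b = a + ?i" | "a = b + ?K - ?i" | "b \<le> a + int c2" "a \<le> b + int c1"
      using less.prems by linarith
    then show ?thesis
    proof cases
      case 1
      have "?H a (b - 1) = ?B a (b - 1)"
        using less.prems ab 1 by (intro less.hyps) auto
      then show ?thesis using cyl_gf_left_boundary[of b a c2 c1]
        Q.cyl_sum_left_boundary[of b a ?i N ?K] 1 by simp
    next
      case 2
      have "?H (a - 1) b = ?B (a - 1) b"
        using less.prems ab 2 by (intro less.hyps) auto
      then show ?thesis
        using cyl_gf_right_boundary[of a b c1 c2] Q.cyl_sum_right_boundary[of a b ?K ?i N] 2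
          less.prems by simp
    next
      case 3
      show ?thesis
      \<comment> \<open>At the origin the factor 1 - x^(a+b) vanishes and the recurrence determines
        nothing, so the value 1 is compared directly.\<close>
      proof (cases "a + b = 0")
        case True
        then have "a = 0" "b = 0" using ab by auto
        then show ?thesis using less.prems Q.cyl_sum_0_0[of ?i ?K N] CP_0
          CP_eq_cyl_gf[of c1 c2 0] by simp
      next
        case False
        have IH: "?H (a - 1) b = ?B (a - 1) b" "?H a (b - 1) =
          ?B a (b - 1)" "?H (a - 1) (b - 1) = ?B (a - 1) (b - 1)"
          using less.prems ab 3 by (intro less.hyps; simp)+
        have X: "fls_X ^ nat (a + b) = (fls_X :: rat fls) powi (a + b)"
          by (rule power_int_nonneg_exp[symmetric]) (use ab in simp)
        have "?H a b = fps_to_fls (q ^ nat (a + b) * cyl_gf c1 c2 a b + cyl_gf c1 c2 (a - 1) b +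
          cyl_gf c1 c2 a (b - 1) - cyl_gf c1 c2 (a - 1) (b - 1))"
          using cyl_gf_rec[OF ab 3] by (rule arg_cong)
        also have "\<dots> = fls_X powi (a + b) * ?H a b + ?B (a - 1) b + ?B a (b - 1) -
          ?B (a - 1) (b - 1)"
          by (simp only: fps_to_fls_plus fps_to_fls_minus fls_times_fps_to_fls fps_to_fls_power
            fps_X_to_fls X IH)
        finally have "(1 - fls_X powi (a + b)) * ?H a b = (1 - fls_X powi (a + b)) * ?B a b"
          unfolding Q.cyl_sum_rec by (simp only: left_diff_distrib mult_1_left)
            (simp only: algebra_simps)
        moreover have "(1 - (fls_X :: rat fls) powi (a + b)) \<noteq> 0"
          using Q.powi_ne_1[of "a + b"] False ab by simp
        ultimately show ?thesis by (simp only: mult_cancel_left) blast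
      qed
    qed
  qed
qed

theorem cylindric_partitions_bosonic:
  assumes "1 \<le> i" "i \<le> k"
  shows "CP (2 * k - i) (i - 1) n = 1 / qpoch q q (2 * n) * (\<Sum>\<^sub>\<infinity>r\<in>UNIV. rhs_term k i n r)"
proof -
  let ?N = "int n + 1"
  \<comment> \<open>This profile gives the strip period \<open>2 * k + 1\<close> and offset
    \<open>i\<close>, exactly the parameters of the right-hand side; equal bounds \<open>n\<close>
    select the diagonal.\<close>
  have K: "int (2 * k - i) + int (i - 1) + 2 = 2 * int k + 1" "int (i - 1) + 1 = int i"
    using assms by auto
  have "fps_to_fls (CP (2 * k - i) (i - 1) n) =
    Q.cyl_sum ?N (2 * int k + 1) (int i) (int n) (int n)"
    using cyl_gf_eq_cyl_sum[of "i - 1" "int n" "int n" "2 * k - i" ?N] unfolding CP_eq_cyl_gf K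
      by simp
  also have "\<dots> = inverse (fps_to_fls (qpoch q q (2 * n))) *
    fps_to_fls (infsum (rhs_term k i n) UNIV)"
    using assms by (simp add: Q.cyl_sum_diagonal fps_to_fls_infsum_rhs[where N =
      ?N] fps_to_fls_qpoch)
  finally have "fps_to_fls (qpoch q q (2 * n) * CP (2 * k - i) (i - 1) n) =
    fps_to_fls (infsum (rhs_term k i n) UNIV)"
    by (simp add: fls_times_fps_to_fls fps_to_fls_qpoch)
  then have *: "qpoch q q (2 * n) * CP (2 * k - i) (i - 1) n = infsum (rhs_term k i n) UNIV"
    by (simp only: fps_to_fls_eq_iff)
  have nz: "qpoch q q (2 * n) $ 0 \<noteq> 0" by (simp add: qpoch_nth_0)
  then show ?thesis
    unfolding *[symmetric] by (simp add: fps_divide_unit mult.assoc[symmetric] inverse_mult_eq_1)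
qed

theorem theorem1p4:
  shows "(\<forall>k\<in>{2, 3, 4}. \<forall>i n. 1 \<le> i \<and> i \<le> k \<longrightarrow>
            (\<Sum>\<^sub>\<infinity>\<nu>\<in>tuples k. lhs_term k i n \<nu>) = (\<Sum>\<^sub>\<infinity>r\<in>UNIV. rhs_term k i n r)) \<and>
         (\<forall>k\<in>{2, 3}. \<forall>i\<in>{1, 2}. \<forall>n.
            CP (2 * k - i) (i - 1) n
              = 1 / qpoch q q (2 * n) * (\<Sum>\<^sub>\<infinity>r\<in>UNIV. rhs_term k i n r))"
proof (intro conjI ballI allI impI)
  fix k i n :: nat
  assume "k \<in> {2, 3, 4}" "1 \<le> i \<and> i \<le> k"
  then show "(\<Sum>\<^sub>\<infinity>\<nu>\<in>tuples k. lhs_term k i n \<nu>) = (\<Sum>\<^sub>\<infinity>r\<in>UNIV. rhs_term k i n r)"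
    by (intro finite_Andrews_Gordon) auto
next
  fix k i n :: nat
  assume "k \<in> {2, 3}" "i \<in> {1, 2}"
  then show "CP (2 * k - i) (i - 1) n
      = 1 / qpoch q q (2 * n) * (\<Sum>\<^sub>\<infinity>r\<in>UNIV. rhs_term k i n r)"
    by (intro cylindric_partitions_bosonic) auto
qed

end
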